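(* Let $T=(X,\hat X,(\phi_\lambda)_{\lambda\in\hat X})$ be a differentiable abstract integral transform with $\hat X\subset\mathbb R^N$ and directions $\zeta_1,\ldots,\zeta_N\in\mathbb R^N$. Let $n\ge1$, and let $(P_t)_{t\ge0}$ be a semigroup of Markov kernels on $X$ related with $T$, with negative definite function $\psi$, such that $P_t(x,\cdot)\in M^1_n(X)$ for all $t\ge0$, $x\in X$, so that the Appell characters $R_\nu$, $|\nu|\le n$, associated with $(P_t)_{t\ge0}$ are defined. Let $(X_t)_{t\ge0}$ be an associated Markov process with the following property: ( * ) There exists $\epsilon>0$ with $\lambda=\sum_{j=1}^N t_j\zeta_j\in\hat X$ for all $0\le t_j\le\epsilon$ $(j=1,\ldots,N)$, and for all $\nu\in\mathbb Z_+^N$ with $|\nu|\le n$ the function $$x\mapsto\sup\Bigl\{|\partial_\lambda^\nu\phi_\lambda(x)|:\ \lambda=\sum_{j=1}^N t_j\zeta_j,\ 0\le t_j\le\epsilon\Bigr\}$$ is integrable with respect to the distribution $P_{X_t}$ of $X_t$, for every $t\ge0$ (in particular these derivatives exist). Then for each $\nu\in\mathbb Z_+^N$ with $|\nu|\le n$, the process $(R_\nu(t,X_t))_{t\ge0}$ is a martingale (with respect to the canonical filtration of $(X_t)_{t\ge0}$).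
   Context: $C_b(X)$, $C_0(X)$ denote continuous complex functions on a locally compact Hausdorff space $X$ that are bounded, respectively vanish at infinity; $M_b(X)$, $M^+(X)$, $M^1(X)$ denote regular Borel measures on $X$ that are bounded, respectively positive (Radon), respectively probability measures. An abstract integral transform is a triple $T=(X,\hat X,(\phi_\lambda)_{\lambda\in\hat X})$ where $X$ is a second countable locally compact space, $\hat X$ a locally compact space, $\phi_\lambda\in C_b(X)$ with $|\phi_\lambda(x)|\le 1$ for all $x,\lambda$, such that: (1) $\lambda\mapsto\phi_\lambda$ is continuous with respect to the compact-uniform topology on $C_b(X)$; (2) there are $e\in X$ with $\phi_\lambda(e)=1$ for all $\lambda\in\hat X$ and $\hat e\in\hat X$ with $\phi_{\hat e}(x)=1$ for all $x\in X$; (3) there is $\pi\in M^+(\hat X)$ such that for all $f\in L^1(\hat X,\pi)$ the function $\check f(x):=\int_{\hat X}f(\lambda)\phi_\lambda(x)\,d\pi(\lambda)$ lies in $C_0(X)$, and $\{\check f: f\in L^1(\hat X,\pi)\}$ is $\|\cdot\|_\infty$-dense in $C_0(X)$. (Spaces are Hausdorff.) $T$ is called differentiable if: $\hat X$ is a closed subset of $\mathbb R^N$ with $\hat e=0\in\hat X$; there are $\zeta_1,\ldots,\zeta_N\in\mathbb R^N$ and $\epsilon>0$ with $t_1\zeta_1+\cdots+t_N\zeta_N\in\hat X$ for all $t_1,\ldots,t_N\in[0,\epsilon]$; and, writing $\partial_\lambda^\nu=\partial_{\zeta_1}^{\nu_1}\cdots\partial_{\zeta_N}^{\nu_N}$ for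 the partial derivatives in the directions $\zeta_j$ (i.e. with respect to $t_1,\dots,t_N$ at $\lambda=\sum_j t_j\zeta_j$; one-sided at the boundary), the moment functions $m_\nu(x):=i^{|\nu|}\,\partial_\lambda^\nu\phi_\lambda(x)|_{\lambda=0}$ exist and are continuous on $X$ for all $\nu\in\mathbb Z_+^N$. Put $M_n^1(X):=\{\mu\in M^1(X): m_\nu\in L^1(X,\mu)\text{ for }|\nu|\le n\}$. For $\mu\in M_b(X)$, $\mu^\wedge(\lambda):=\int_X\phi_\lambda\,d\mu$. A Markov kernel $P$ on $X$ is related with $T$ if $P(x,\cdot)^\wedge(\lambda)=P(e,\cdot)^\wedge(\lambda)\phi_\lambda(x)$ for all $x,\lambda$. A (continuous) semigroup $(P_t)_{t\ge0}$ of Markov kernels related with $T$ satisfies $P_s\circ P_t=P_{s+t}$ (with $P\circ Q(x,A)=\int_X Q(z,A)P(x,dz)$), $P_0(x,\cdot)=\delta_x$, and $t\mapsto P_t(e,\cdot)\in M^1(X)$ is weakly continuous; its negative definite function is the unique continuous $\psi:\hat X\to\mathbb C$ with $P_t(e,\cdot)^\wedge=e^{-t\psi}$ for all $t\ge0$, namely $\psi(\lambda)=\lim_{t\downarrow0}\frac1t(1-P_t(e,\cdot)^\wedge(\lambda))$. An associated Markov process satisfies $P(X_t\in B\mid\sigma(X_u:u\le s))=P_{t-s}(X_s,B)$ a.s. for $s\le t$. Setting for Appell characters: with $P_t(x,\cdot)\in M_n^1(X)$ for all $t\ge0$, $x\in X$, it is part of the setting that $e^{-t\psi}=P_t(e,\cdot)^\wedge$,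 and hence $\lambda\mapsto\phi_\lambda(x)e^{t\psi(\lambda)}$, is $n$-times continuously differentiable (in the sense of the derivatives $\partial_\lambda^\nu$ above). The Appell characters associated with $(P_t)_{t\ge 0}$ are $$R_\nu(t,x):=i^{|\nu|}\,\partial_\lambda^\nu\bigl(\phi_\lambda(x)e^{t\psi(\lambda)}\bigr)\big|_{\lambda=0}\qquad(\nu\in\mathbb Z_+^N,\ |\nu|\le n).$$ *)

theory Defs
  imports "HOL-Probability.Probability"
begin

subsection \<open>Function spaces and measures\<close>

definition bounded_continuous :: "('x::topological_space \<Rightarrow> complex) set" where
  "bounded_continuous = {f. continuous_on UNIV f \<and> bounded (range f)}"

definition vanishing_at_infinity :: "('x::topological_space \<Rightarrow> complex) set" where
  "vanishing_at_infinity =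
     {f. continuous_on UNIV f \<and> (\<forall>\<delta>>0. compact {x. \<delta> \<le> cmod (f x)})}"

text \<open>Borel measures on a subspace \<open>S\<close> that are finite on compact sets and inner regular. The
  measure lives on the subspace itself, so its \<open>\<sigma>\<close>-algebra is the trace of the ambient Borel sets.\<close>

definition radon_measure_on :: "'a::t2_space set \<Rightarrow> 'a measure \<Rightarrow> bool" where
  "radon_measure_on S \<mu> \<longleftrightarrow>
     space \<mu> = S \<and> sets \<mu> = sets (restrict_space borel S) \<and>
     (\<forall>K. compact K \<and> K \<subseteq> S \<longrightarrow> emeasure \<mu> K < \<infinity>) \<and>
     (\<forall>A\<in>sets \<mu>. emeasure \<mu> A = (SUP K\<in>{K. compact K \<and> K \<subseteq> A}. emeasure \<mu> K))"

definition regular_prob_measures :: "'x::t2_space measure set" where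
  "regular_prob_measures = {\<mu>. prob_space \<mu> \<and> radon_measure_on UNIV \<mu>}"


subsection \<open>Abstract integral transforms\<close>

text \<open>The space \<open>X\<close> is the type \<open>'x\<close>; the dual space is a subspace \<open>Xhat\<close> of a Hausdorff space.\<close>

locale abstract_integral_transform =
  fixes Xhat :: "'l::t2_space set"
    and \<phi> :: "'l \<Rightarrow> 'x::{second_countable_topology, t2_space} \<Rightarrow> complex"
    and e :: 'x and ehat :: 'l
  assumes locally_compact_X: "locally_compact_space (euclidean :: 'x topology)"
    and locally_compact_Xhat: "locally_compact_space (top_of_set Xhat)"
    and \<phi>_bounded_continuous: "l \<in> Xhat \<Longrightarrow> \<phi> l \<in> bounded_continuous"
    and \<phi>_le_1: "l \<in> Xhat \<Longrightarrow> cmod (\<phi> l x) \<le> 1"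
    and \<phi>_compact_uniform:
      "compact K \<Longrightarrow> l \<in> Xhat \<Longrightarrow> uniform_limit K \<phi> (\<phi> l) (at l within Xhat)"
    and \<phi>_e: "l \<in> Xhat \<Longrightarrow> \<phi> l e = 1"
    and ehat_in: "ehat \<in> Xhat"
    and \<phi>_ehat: "\<phi> ehat x = 1"
    and inverse_transform:
      "\<exists>\<pi>. radon_measure_on Xhat \<pi> \<and>
         (\<forall>f :: 'l \<Rightarrow> complex. integrable \<pi> f \<longrightarrow>
            (\<lambda>x. LINT l|\<pi>. f l * \<phi> l x) \<in> vanishing_at_infinity) \<and>
         (\<forall>g\<in>vanishing_at_infinity. \<forall>\<delta>>0. \<exists>f :: 'l \<Rightarrow> complex. integrable \<pi> f \<and>
            (\<forall>x. cmod ((LINT l|\<pi>. f l * \<phi> l x) - g x) \<le> \<delta>))"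

definition fourier_transform ::
    "('l \<Rightarrow> 'x \<Rightarrow> complex) \<Rightarrow> 'x measure \<Rightarrow> 'l \<Rightarrow> complex" where
  "fourier_transform \<phi> \<mu> l = (LINT x|\<mu>. \<phi> l x)"


subsection \<open>Partial derivatives in given directions\<close>

definition param_box :: "real \<Rightarrow> (real^'n) set" where
  "param_box \<epsilon> = {t. \<forall>j. 0 \<le> t $ j \<and> t $ j \<le> \<epsilon>}"

definition dir_point :: "('n::finite \<Rightarrow> real^'n) \<Rightarrow> real^'n \<Rightarrow> real^'n" where
  "dir_point \<zeta> t = (\<Sum>j\<in>UNIV. (t $ j) *\<^sub>R \<zeta> j)"

definition upd_coord :: "real^'n \<Rightarrow> 'n \<Rightarrow> real \<Rightarrow> real^'n" where
  "upd_coord t j s = (\<chi> k. if k = j then s else t $ k)"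

text \<open>For a list \<open>[j1, ..., jk]\<close> of coordinates, \<open>iter_pderiv \<epsilon> [j1, ..., jk] F\<close> is
  \<open>(d/dt_j1) ... (d/dt_jk) F\<close>, the rightmost derivative being taken first, for a function \<open>F\<close> on
  the box \<open>[0,\<epsilon>]^N\<close>; derivatives are one-sided on the boundary of the box.\<close>

primrec iter_pderiv ::
    "real \<Rightarrow> 'n list \<Rightarrow> (real^'n \<Rightarrow> complex) \<Rightarrow> real^'n \<Rightarrow> complex" where
  "iter_pderiv \<epsilon> [] F = F"
| "iter_pderiv \<epsilon> (j # js) F =
     (\<lambda>t. vector_derivative (\<lambda>s. iter_pderiv \<epsilon> js F (upd_coord t j s)) (at (t $ j) within {0..\<epsilon>}))"

text \<open>Existence of the iterated derivative at the point \<open>t\<close>: the inner derivative has to exist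
  at \<open>t\<close> and at nearby points of the box in the outermost direction.\<close>

primrec iter_pderiv_exists ::
    "real \<Rightarrow> 'n list \<Rightarrow> (real^'n \<Rightarrow> complex) \<Rightarrow> real^'n \<Rightarrow> bool" where
  "iter_pderiv_exists \<epsilon> [] F = (\<lambda>t. True)"
| "iter_pderiv_exists \<epsilon> (j # js) F =
     (\<lambda>t. (\<forall>\<^sub>F s in inf (nhds (t $ j)) (principal {0..\<epsilon>}).
              iter_pderiv_exists \<epsilon> js F (upd_coord t j s)) \<and>
          (\<lambda>s. iter_pderiv \<epsilon> js F (upd_coord t j s)) differentiable (at (t $ j) within {0..\<epsilon>}))"

definition multi_order :: "('n::finite \<Rightarrow> nat) \<Rightarrow> nat" where
  "multi_order \<nu> = (\<Sum>j\<in>UNIV. \<nu> j)"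

text \<open>The index type is linearly ordered so that the order of differentiation is fixed:
  \<open>\<nu>\<close> stands for the list with \<open>\<nu> j\<close> copies of each \<open>j\<close>, in increasing order.\<close>

definition multi_coords :: "('n::{finite,linorder} \<Rightarrow> nat) \<Rightarrow> 'n list" where
  "multi_coords \<nu> = concat (map (\<lambda>j. replicate (\<nu> j) j) (sorted_list_of_set UNIV))"

text \<open>The derivative of \<open>f\<close> of multi-order \<open>\<nu>\<close> in the directions \<open>\<zeta>\<close>, at \<open>dir_point \<zeta> t\<close>. At
  \<open>t = 0\<close> it does not depend on \<open>\<epsilon>\<close>.\<close>

definition dir_deriv ::
    "real \<Rightarrow> ('n::{finite,linorder} \<Rightarrow> (real, 'n) vec) \<Rightarrow> ('n \<Rightarrow> nat) \<Rightarrow>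
     ((real, 'n) vec \<Rightarrow> complex) \<Rightarrow> (real, 'n) vec \<Rightarrow> complex" where
  "dir_deriv \<epsilon> \<zeta> \<nu> f t = iter_pderiv \<epsilon> (multi_coords \<nu>) (\<lambda>s. f (dir_point \<zeta> s)) t"

definition dir_deriv_exists ::
    "real \<Rightarrow> ('n::{finite,linorder} \<Rightarrow> (real, 'n) vec) \<Rightarrow> ('n \<Rightarrow> nat) \<Rightarrow>
     ((real, 'n) vec \<Rightarrow> complex) \<Rightarrow> (real, 'n) vec \<Rightarrow> bool" where
  "dir_deriv_exists \<epsilon> \<zeta> \<nu> f t =
     iter_pderiv_exists \<epsilon> (multi_coords \<nu>) (\<lambda>s. f (dir_point \<zeta> s)) t"

definition dir_cont_diff ::
    "real \<Rightarrow> ('n::{finite,linorder} \<Rightarrow> (real, 'n) vec) \<Rightarrow> nat \<Rightarrow> ((real, 'n) vec \<Rightarrow> complex) \<Rightarrow> bool" where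
  "dir_cont_diff \<epsilon> \<zeta> n f \<longleftrightarrow>
     (\<forall>\<nu>. multi_order \<nu> \<le> n \<longrightarrow>
        (\<forall>t\<in>param_box \<epsilon>. dir_deriv_exists \<epsilon> \<zeta> \<nu> f t) \<and>
        continuous_on (param_box \<epsilon>) (dir_deriv \<epsilon> \<zeta> \<nu> f))"


subsection \<open>Differentiable transforms and moment functions\<close>

definition moment_function ::
    "((real, 'n::{finite,linorder}) vec \<Rightarrow> 'x \<Rightarrow> complex) \<Rightarrow> real \<Rightarrow> ('n \<Rightarrow> (real, 'n) vec) \<Rightarrow>
     ('n \<Rightarrow> nat) \<Rightarrow> 'x \<Rightarrow> complex" where
  "moment_function \<phi> \<epsilon> \<zeta> \<nu> x = \<i> ^ multi_order \<nu> * dir_deriv \<epsilon> \<zeta> \<nu> (\<lambda>l. \<phi> l x) 0"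

locale differentiable_integral_transform =
  abstract_integral_transform Xhat \<phi> e 0
  for Xhat :: "(real, 'n::{finite,linorder}) vec set"
    and \<phi> :: "(real, 'n) vec \<Rightarrow> 'x::{second_countable_topology, t2_space} \<Rightarrow> complex"
    and e :: 'x +
  fixes \<zeta> :: "'n \<Rightarrow> (real, 'n) vec" and \<epsilon> :: real
  assumes closed_Xhat: "closed Xhat"
    and \<epsilon>_pos: "\<epsilon> > 0"
    and dir_point_in: "t \<in> param_box \<epsilon> \<Longrightarrow> dir_point \<zeta> t \<in> Xhat"
    and moment_function_exists: "dir_deriv_exists \<epsilon> \<zeta> \<nu> (\<lambda>l. \<phi> l x) 0"
    and moment_function_continuous: "continuous_on UNIV (moment_function \<phi> \<epsilon> \<zeta> \<nu>)"

definition prob_measures_with_moments ::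
    "((real, 'n::{finite,linorder}) vec \<Rightarrow> 'x::t2_space \<Rightarrow> complex) \<Rightarrow> real \<Rightarrow> ('n \<Rightarrow> (real, 'n) vec) \<Rightarrow>
     nat \<Rightarrow> 'x measure set" where
  "prob_measures_with_moments \<phi> \<epsilon> \<zeta> n =
     {\<mu> \<in> regular_prob_measures.
        \<forall>\<nu>. multi_order \<nu> \<le> n \<longrightarrow> integrable \<mu> (moment_function \<phi> \<epsilon> \<zeta> \<nu>)}"


subsection \<open>Semigroups of related Markov kernels\<close>

definition related_kernel ::
    "'l set \<Rightarrow> ('l \<Rightarrow> 'x::topological_space \<Rightarrow> complex) \<Rightarrow> 'x \<Rightarrow> ('x \<Rightarrow> 'x measure) \<Rightarrow> bool" where
  "related_kernel Xhat \<phi> e Q \<longleftrightarrow>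
     Q \<in> borel \<rightarrow>\<^sub>M prob_algebra borel \<and>
     (\<forall>x. \<forall>l\<in>Xhat. fourier_transform \<phi> (Q x) l = fourier_transform \<phi> (Q e) l * \<phi> l x)"

definition related_semigroup ::
    "'l set \<Rightarrow> ('l \<Rightarrow> 'x::topological_space \<Rightarrow> complex) \<Rightarrow> 'x \<Rightarrow>
     (real \<Rightarrow> 'x \<Rightarrow> 'x measure) \<Rightarrow> bool" where
  "related_semigroup Xhat \<phi> e P \<longleftrightarrow>
     (\<forall>t\<ge>0. related_kernel Xhat \<phi> e (P t)) \<and>
     (\<forall>s\<ge>0. \<forall>t\<ge>0. \<forall>x. bind (P s x) (P t) = P (s + t) x) \<and>
     (\<forall>x. P 0 x = return borel x) \<and>
     (\<forall>f\<in>bounded_continuous. continuous_on {0..} (\<lambda>t. LINT x|P t e. f x))"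

definition negative_definite_function_of ::
    "'l::topological_space set \<Rightarrow> ('l \<Rightarrow> 'x \<Rightarrow> complex) \<Rightarrow> 'x \<Rightarrow>
     (real \<Rightarrow> 'x \<Rightarrow> 'x measure) \<Rightarrow> ('l \<Rightarrow> complex) \<Rightarrow> bool" where
  "negative_definite_function_of Xhat \<phi> e P \<psi> \<longleftrightarrow>
     continuous_on Xhat \<psi> \<and>
     (\<forall>t\<ge>0. \<forall>l\<in>Xhat. fourier_transform \<phi> (P t e) l = exp (- complex_of_real t * \<psi> l))"


subsection \<open>Appell characters\<close>

definition appell_character ::
    "((real, 'n::{finite,linorder}) vec \<Rightarrow> 'x \<Rightarrow> complex) \<Rightarrow> real \<Rightarrow> ('n \<Rightarrow> (real, 'n) vec) \<Rightarrow>
     ((real, 'n) vec \<Rightarrow> complex) \<Rightarrow> ('n \<Rightarrow> nat) \<Rightarrow> real \<Rightarrow> 'x \<Rightarrow> complex" where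
  "appell_character \<phi> \<epsilon> \<zeta> \<psi> \<nu> t x =
     \<i> ^ multi_order \<nu> *
     dir_deriv \<epsilon> \<zeta> \<nu> (\<lambda>l. \<phi> l x * exp (complex_of_real t * \<psi> l)) 0"

definition appell_setting ::
    "((real, 'n::{finite,linorder}) vec \<Rightarrow> 'x::t2_space \<Rightarrow> complex) \<Rightarrow> real \<Rightarrow> ('n \<Rightarrow> (real, 'n) vec) \<Rightarrow>
     nat \<Rightarrow> (real \<Rightarrow> 'x \<Rightarrow> 'x measure) \<Rightarrow> ((real, 'n) vec \<Rightarrow> complex) \<Rightarrow> bool" where
  "appell_setting \<phi> \<epsilon> \<zeta> n P \<psi> \<longleftrightarrow>
     (\<forall>t\<ge>0. \<forall>x. P t x \<in> prob_measures_with_moments \<phi> \<epsilon> \<zeta> n) \<and>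
     (\<forall>t\<ge>0. dir_cont_diff \<epsilon> \<zeta> n (\<lambda>l. exp (- complex_of_real t * \<psi> l))) \<and>
     (\<forall>t\<ge>0. \<forall>x. dir_cont_diff \<epsilon> \<zeta> n (\<lambda>l. \<phi> l x * exp (complex_of_real t * \<psi> l)))"


subsection \<open>Markov processes and martingales\<close>

text \<open>Time is \<open>[0,\<infinity>)\<close>; values at negative times are irrelevant throughout.\<close>

definition canonical_filtration ::
    "'w measure \<Rightarrow> (real \<Rightarrow> 'w \<Rightarrow> 'x::topological_space) \<Rightarrow> real \<Rightarrow> 'w measure" where
  "canonical_filtration M X t =
     sigma (space M) {X u -` B \<inter> space M | u B. 0 \<le> u \<and> u \<le> t \<and> B \<in> sets borel}"

definition markov_process ::
    "'w measure \<Rightarrow> (real \<Rightarrow> 'x \<Rightarrow> 'x measure) \<Rightarrow> (real \<Rightarrow> 'w \<Rightarrow> 'x::topological_space) \<Rightarrow> bool" where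
  "markov_process M P X \<longleftrightarrow>
     prob_space M \<and>
     (\<forall>t\<ge>0. X t \<in> M \<rightarrow>\<^sub>M borel) \<and>
     (\<forall>s\<ge>0. \<forall>t\<ge>s. \<forall>B\<in>sets borel.
        AE w in M. real_cond_exp M (canonical_filtration M X s) (indicator (X t -` B \<inter> space M)) w
                   = measure (P (t - s) (X s w)) B)"

definition complex_cond_exp ::
    "'w measure \<Rightarrow> 'w measure \<Rightarrow> ('w \<Rightarrow> complex) \<Rightarrow> 'w \<Rightarrow> complex" where
  "complex_cond_exp M G f w =
     Complex (real_cond_exp M G (\<lambda>v. Re (f v)) w) (real_cond_exp M G (\<lambda>v. Im (f v)) w)"

definition martingale ::
    "'w measure \<Rightarrow> (real \<Rightarrow> 'w measure) \<Rightarrow> (real \<Rightarrow> 'w \<Rightarrow> complex) \<Rightarrow> bool" where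
  "martingale M F Y \<longleftrightarrow>
     (\<forall>t\<ge>0. subalgebra M (F t)) \<and>
     (\<forall>s\<ge>0. \<forall>t\<ge>s. sets (F s) \<subseteq> sets (F t)) \<and>
     (\<forall>t\<ge>0. Y t \<in> borel_measurable (F t) \<and> integrable M (Y t)) \<and>
     (\<forall>s\<ge>0. \<forall>t\<ge>s. AE w in M. complex_cond_exp M (F s) (Y t) w = Y s w)"

text \<open>The supremum is taken in \<open>[0,\<infinity>]\<close>, so it may be infinite on a null set.\<close>

definition deriv_sup ::
    "((real, 'n::{finite,linorder}) vec \<Rightarrow> 'x \<Rightarrow> complex) \<Rightarrow> real \<Rightarrow> ('n \<Rightarrow> (real, 'n) vec) \<Rightarrow>
     ('n \<Rightarrow> nat) \<Rightarrow> 'x \<Rightarrow> ennreal" where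
  "deriv_sup \<phi> \<epsilon> \<zeta> \<nu> x =
     (SUP t\<in>param_box \<epsilon>. ennreal (cmod (dir_deriv \<epsilon> \<zeta> \<nu> (\<lambda>l. \<phi> l x) t)))"

definition derivs_sup_integrable ::
    "(real, 'n::{finite,linorder}) vec set \<Rightarrow> ((real, 'n) vec \<Rightarrow> 'x::topological_space \<Rightarrow> complex) \<Rightarrow>
     ('n \<Rightarrow> (real, 'n) vec) \<Rightarrow> nat \<Rightarrow> 'w measure \<Rightarrow> (real \<Rightarrow> 'w \<Rightarrow> 'x) \<Rightarrow> bool" where
  "derivs_sup_integrable Xhat \<phi> \<zeta> n M X \<longleftrightarrow>
     (\<exists>\<epsilon>>0. (\<forall>t\<in>param_box \<epsilon>. dir_point \<zeta> t \<in> Xhat) \<and>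
        (\<forall>\<nu>. multi_order \<nu> \<le> n \<longrightarrow>
           (\<forall>x. \<forall>t\<in>param_box \<epsilon>. dir_deriv_exists \<epsilon> \<zeta> \<nu> (\<lambda>l. \<phi> l x) t) \<and>
           deriv_sup \<phi> \<epsilon> \<zeta> \<nu> \<in> borel_measurable borel \<and>
           (\<forall>t\<ge>0. (\<integral>\<^sup>+x. deriv_sup \<phi> \<epsilon> \<zeta> \<nu> x \<partial>distr M borel (X t)) < \<infinity>)))"

end

(* For l in the dual space the Markov property and the relation of the kernels with the transform
   give E[1_A phi_l(X_t)] e^{t psi(l)} = E[1_A phi_l(X_s)] e^{s psi(l)} for A in F_s. Differentiating
   this identity in l at 0 yields E[1_A R_nu(t,X_t)] = E[1_A R_nu(s,X_s)]. The derivatives pass under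
   the expectation by dominated convergence: the Leibniz rule bounds those of phi_l(x) e^{t psi(l)}
   on a small box by the integrable suprema of the derivatives of phi_l(x) times constants. The
   regularity of e^{t psi} on the box comes from the Appell setting at x = e, where phi_l(e) = 1. *)

theory Submission
  imports Defs "HOL-Library.Sublist" "HOL-Library.Multiset"
begin

subsection \<open>Differentiation under the integral sign\<close>

text \<open>Two obstacles shape the proof. First, all hypotheses concern multi-indices, that is,
  derivatives taken in one fixed order, and no symmetry of mixed derivatives is at hand. The
  calculus is therefore done for lists of coordinates. Every partial derivative that arises, whether
  an intermediate one or a factor in the Leibniz rule, belongs to a subsequence of a sorted list.
  Such a subsequence is sorted, so it again stands for a multi-index of order at most
  \<open>n\<close>.

  Second, the Appell characters are formed on the box of side \<epsilon>, while the integrable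
  suprema come with a box of their own. Everything is moved to the smaller box. One-sided
  derivatives do not change there, and an identity valid only on that box already determines the
  derivative at 0.

  Differentiation under the integral proceeds one coordinate at a time. Restriction to an event is
  absorbed into the measure as a density, so only plain integrals are differentiated. The Markov
  property, given for indicators, reaches the functions \<phi> because it identifies the law of the
  process at the later time on an event with a mixture of kernels.\<close>

lemma has_vector_derivative_iff_quotient:
  fixes f :: "real \<Rightarrow> 'a::real_normed_vector"
  shows "(f has_vector_derivative D) (at x within S) \<longleftrightarrow>
    ((\<lambda>s. (f s - f x) /\<^sub>R (s - x)) \<longlongrightarrow> D) (at x within S)"
proof -
  have eq: "norm (f s - f x - (s - x) *\<^sub>R D) / norm (s - x) = norm ((f s - f x) /\<^sub>R (s - x) - D)"
    if "s \<noteq> x" for s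
  proof -
    have "(f s - f x) /\<^sub>R (s - x) - D = (f s - f x - (s - x) *\<^sub>R D) /\<^sub>R (s - x)"
      using that by (simp add: scaleR_diff_right)
    then show ?thesis by (simp add: divide_inverse mult.commute)
  qed
  have "(f has_vector_derivative D) (at x within S) \<longleftrightarrow>
      ((\<lambda>s. norm (f s - f x - (s - x) *\<^sub>R D) / norm (s - x)) \<longlongrightarrow> 0) (at x within S)"
    by (simp add: has_vector_derivative_def has_derivative_iff_norm bounded_linear_scaleR_left)
  also have "\<dots> \<longleftrightarrow> ((\<lambda>s. norm ((f s - f x) /\<^sub>R (s - x) - D)) \<longlongrightarrow> 0) (at x within S)"
    by (rule filterlim_cong) (simp_all add: eventually_at_filter eq del: real_norm_def)
  also have "\<dots> \<longleftrightarrow> ((\<lambda>s. (f s - f x) /\<^sub>R (s - x)) \<longlongrightarrow> D) (at x within S)"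
    by (simp add: tendsto_norm_zero_iff LIM_zero_iff)
  finally show ?thesis .
qed

text \<open>Mean value inequality on an interval. A bound on the derivative over the whole interval
  becomes a bound on all difference quotients.\<close>

lemma vector_derivative_norm_bound:
  fixes f :: "real \<Rightarrow> 'a::real_normed_vector"
  assumes der: "\<And>s. s \<in> {a..b} \<Longrightarrow> (f has_vector_derivative f' s) (at s within {a..b})"
    and bound: "\<And>s. s \<in> {a..b} \<Longrightarrow> norm (f' s) \<le> B"
    and "s \<in> {a..b}" "x \<in> {a..b}"
  shows "norm (f s - f x) \<le> B * \<bar>s - x\<bar>"
proof -
  have "norm (f s - f x) \<le> B * norm (s - x)"
  proof (rule differentiable_bound[where S = "{a..b}" and f' = "\<lambda>s h. h *\<^sub>R f' s"])
    show "(f has_derivative (\<lambda>h. h *\<^sub>R f' s)) (at s within {a..b})" if "s \<in> {a..b}" for s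
      using der[OF that] by (simp add: has_vector_derivative_def)
    show "onorm (\<lambda>h. h *\<^sub>R f' s) \<le> B" if "s \<in> {a..b}" for s
      by (rule onorm_le) (use mult_right_mono[OF bound[OF that] abs_ge_zero] in \<open>simp add: mult.commute\<close>)
  qed (use assms in auto)
  then show ?thesis by simp
qed

text \<open>By the mean value inequality \<open>h\<close> majorizes every difference quotient, and
  dominated convergence applies along each sequence tending to \<open>x\<close>. The null set in
  \<open>dom\<close> must not depend on \<open>s\<close>, since that inequality for a fixed
  \<open>w\<close> uses the derivative on the whole interval.\<close>

lemma has_vector_derivative_integral_dominated:
  fixes f f' :: "real \<Rightarrow> 'w \<Rightarrow> 'a::{banach, second_countable_topology}"
  assumes ab: "a < b" and x: "x \<in> {a..b}"
    and int: "\<And>s. s \<in> {a..b} \<Longrightarrow> integrable M (f s)"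
    and der: "\<And>w s. w \<in> space M \<Longrightarrow> s \<in> {a..b} \<Longrightarrow>
      ((\<lambda>s. f s w) has_vector_derivative f' s w) (at s within {a..b})"
    and h: "integrable M h"
    and dom: "AE w in M. \<forall>s\<in>{a..b}. norm (f' s w) \<le> h w"
    and meas: "f' x \<in> borel_measurable M"
  shows "((\<lambda>s. \<integral>w. f s w \<partial>M) has_vector_derivative (\<integral>w. f' x w \<partial>M)) (at x within {a..b})"
  unfolding has_vector_derivative_iff_quotient tendsto_at_iff_sequentially comp_def
proof (intro allI impI)
  fix S :: "nat \<Rightarrow> real"
  assume "\<forall>i. S i \<in> {a..b} - {x}" and S: "S \<longlonglongrightarrow> x"
  then have Si: "S i \<in> {a..b}" "S i \<noteq> x" for i by auto
  have "(\<lambda>i. \<integral>w. (f (S i) w - f x w) /\<^sub>R (S i - x) \<partial>M) \<longlonglongrightarrow> (\<integral>w. f' x w \<partial>M)"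
  proof (rule integral_dominated_convergence[where w = h])
    show "(\<lambda>w. (f (S i) w - f x w) /\<^sub>R (S i - x)) \<in> borel_measurable M" for i
      using int[OF Si(1)[of i]] int[OF x] by measurable
    show "AE w in M. (\<lambda>i. (f (S i) w - f x w) /\<^sub>R (S i - x)) \<longlonglongrightarrow> f' x w"
    proof (rule AE_I2)
      fix w assume "w \<in> space M"
      from der[OF this x] show "(\<lambda>i. (f (S i) w - f x w) /\<^sub>R (S i - x)) \<longlonglongrightarrow> f' x w"
        unfolding has_vector_derivative_iff_quotient tendsto_at_iff_sequentially comp_def
        using Si S by auto
    qed
    fix i
    show "AE w in M. norm ((f (S i) w - f x w) /\<^sub>R (S i - x)) \<le> h w"
      using dom AE_space
    proof eventually_elim
      case (elim w)
      have "norm (f (S i) w - f x w) \<le> h w * \<bar>S i - x\<bar>"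
        by (rule vector_derivative_norm_bound[OF der]) (use elim Si x in auto)
      then show ?case using Si(2)[of i] by (simp add: divide_simps mult.commute flip: divide_inverse_commute)
    qed
  qed (use h meas in auto)
  moreover have "(\<integral>w. (f (S i) w - f x w) /\<^sub>R (S i - x) \<partial>M) =
      ((\<integral>w. f (S i) w \<partial>M) - (\<integral>w. f x w \<partial>M)) /\<^sub>R (S i - x)" for i
    using int[OF Si(1)[of i]] int[OF x] by (simp del: scaleR_right_diff_distrib)
  ultimately show "(\<lambda>i. ((\<integral>w. f (S i) w \<partial>M) - (\<integral>w. f x w \<partial>M)) /\<^sub>R (S i - x))
      \<longlonglongrightarrow> (\<integral>w. f' x w \<partial>M)"
    by (simp only:)
qed

subsection \<open>Iterated derivatives on a box\<close>

lemma upd_coord_in_param_box [simp]: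
  "t \<in> param_box \<epsilon> \<Longrightarrow> s \<in> {0..\<epsilon>} \<Longrightarrow> upd_coord t j s \<in> param_box \<epsilon>"
  by (auto simp: param_box_def upd_coord_def)

lemma upd_coord_nth [simp]: "upd_coord t j s $ j = s"
  by (simp add: upd_coord_def)

lemma upd_coord_same [simp]: "upd_coord t j (t $ j) = t"
  by (simp add: upd_coord_def vec_eq_iff)

lemma upd_coord_upd_coord [simp]: "upd_coord (upd_coord t j r) j s = upd_coord t j s"
  by (auto simp: upd_coord_def vec_eq_iff)

lemma param_box_nth: "t \<in> param_box \<epsilon> \<Longrightarrow> t $ j \<in> {0..\<epsilon>}"
  by (auto simp: param_box_def)

lemma param_box_mono: "\<delta> \<le> \<epsilon> \<Longrightarrow> param_box \<delta> \<subseteq> param_box \<epsilon>"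
  by (auto simp: param_box_def intro: order_trans)

lemma zero_in_param_box: "0 \<le> \<epsilon> \<Longrightarrow> 0 \<in> param_box \<epsilon>"
  by (auto simp: param_box_def)

lemma compact_param_box: "compact (param_box \<epsilon> :: (real^'n) set)"
proof -
  have "(param_box \<epsilon> :: (real^'n) set) = cbox 0 (\<chi> i. \<epsilon>)"
    by (auto simp: param_box_def mem_box_cart)
  then show ?thesis by simp
qed

definition differentiable_along ::
    "real \<Rightarrow> 'n list \<Rightarrow> (real^'n \<Rightarrow> complex) \<Rightarrow> bool" where
  "differentiable_along \<epsilon> js F \<longleftrightarrow> (\<forall>t\<in>param_box \<epsilon>. iter_pderiv_exists \<epsilon> js F t)"

lemma differentiable_along_Nil [simp]: "differentiable_along \<epsilon> [] F"
  by (simp add: differentiable_along_def)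

text \<open>The filter \<open>nhds\<close> is not punctured, so the eventual existence of the inner
  derivative includes the point itself, where \<open>upd_coord\<close> changes nothing.\<close>

lemma differentiable_along_tail:
  assumes "differentiable_along \<epsilon> (j # js) F"
  shows "differentiable_along \<epsilon> js F"
  unfolding differentiable_along_def
proof
  fix t :: "real^'a" assume t: "t \<in> param_box \<epsilon>"
  with assms have "\<forall>\<^sub>F s in nhds (t $ j). s \<in> {0..\<epsilon>} \<longrightarrow> iter_pderiv_exists \<epsilon> js F (upd_coord t j s)"
    by (simp add: differentiable_along_def eventually_inf_principal)
  from eventually_nhds_x_imp_x[OF this] show "iter_pderiv_exists \<epsilon> js F t"
    using param_box_nth[OF t, of j] by simp
qed

lemma differentiable_along_deriv:
  assumes "differentiable_along \<epsilon> (j # js) F" "t \<in> param_box \<epsilon>"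
  shows "((\<lambda>s. iter_pderiv \<epsilon> js F (upd_coord t j s)) has_vector_derivative
    iter_pderiv \<epsilon> (j # js) F t) (at (t $ j) within {0..\<epsilon>})"
  using assms by (simp add: differentiable_along_def vector_derivative_works)

lemma differentiable_along_deriv_upd:
  assumes "differentiable_along \<epsilon> (j # js) F" "t \<in> param_box \<epsilon>" "s \<in> {0..\<epsilon>}"
  shows "((\<lambda>s. iter_pderiv \<epsilon> js F (upd_coord t j s)) has_vector_derivative
    iter_pderiv \<epsilon> (j # js) F (upd_coord t j s)) (at s within {0..\<epsilon>})"
  using differentiable_along_deriv[OF assms(1) upd_coord_in_param_box[OF assms(2,3)], of j] by simp

lemma differentiable_along_ConsI:
  assumes "differentiable_along \<epsilon> js F"
    and "\<And>t. t \<in> param_box \<epsilon> \<Longrightarrow>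
      (\<lambda>s. iter_pderiv \<epsilon> js F (upd_coord t j s)) differentiable (at (t $ j) within {0..\<epsilon>})"
  shows "differentiable_along \<epsilon> (j # js) F"
  using assms by (auto simp: differentiable_along_def eventually_inf_principal intro!: always_eventually)

text \<open>With \<epsilon> positive the interval is nondegenerate, so derivatives within it are
  unique even at its end points.\<close>

lemma iter_pderiv_ConsI:
  assumes "\<epsilon> > 0" "t \<in> param_box \<epsilon>"
    and "((\<lambda>s. iter_pderiv \<epsilon> js F (upd_coord t j s)) has_vector_derivative D)
      (at (t $ j) within {0..\<epsilon>})"
  shows "iter_pderiv \<epsilon> (j # js) F t = D"
  using vector_derivative_within_closed_interval[OF assms(1) param_box_nth[OF assms(2)] assms(3)]
  by simp

text \<open>All difference quotients stay in the box, so values outside it never enter. Hence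
  identities that hold only for points of the dual space can be differentiated.\<close>

lemma iter_pderiv_cong:
  assumes eq: "\<And>t. t \<in> param_box \<epsilon> \<Longrightarrow> F t = G t" and "t \<in> param_box \<epsilon>"
  shows "iter_pderiv \<epsilon> js F t = iter_pderiv \<epsilon> js G t"
  using assms(2)
proof (induction js arbitrary: t)
  case (Cons j js)
  have "((\<lambda>s. iter_pderiv \<epsilon> js F (upd_coord t j s)) has_vector_derivative D)
      (at (t $ j) within {0..\<epsilon>}) \<longleftrightarrow>
    ((\<lambda>s. iter_pderiv \<epsilon> js G (upd_coord t j s)) has_vector_derivative D)
      (at (t $ j) within {0..\<epsilon>})" for D
    by (rule has_vector_derivative_cong_ev)
       (use Cons param_box_nth[OF Cons.prems, of j] in auto)
  then show ?case by (simp add: vector_derivative_def)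
qed (use eq in auto)

text \<open>A derivative within an interval is also one within a nondegenerate subinterval, and
  uniqueness there identifies the two. This brings boxes of different sides to a common one.\<close>

lemma iter_pderiv_restrict:
  assumes "differentiable_along \<epsilon> js F" "0 < \<delta>" "\<delta> \<le> \<epsilon>"
  shows "differentiable_along \<delta> js F"
    and "t \<in> param_box \<delta> \<Longrightarrow> iter_pderiv \<delta> js F t = iter_pderiv \<epsilon> js F t"
proof -
  have "differentiable_along \<delta> js F \<and>
      (\<forall>t\<in>param_box \<delta>. iter_pderiv \<delta> js F t = iter_pderiv \<epsilon> js F t)"
    using assms(1)
  proof (induction js)
    case (Cons j js)
    note IH = Cons.IH[OF differentiable_along_tail[OF Cons.prems]]
    have der: "((\<lambda>s. iter_pderiv \<delta> js F (upd_coord t j s)) has_vector_derivative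
        iter_pderiv \<epsilon> (j # js) F t) (at (t $ j) within {0..\<delta>})" if t: "t \<in> param_box \<delta>" for t
    proof (rule has_vector_derivative_transform)
      show "((\<lambda>s. iter_pderiv \<epsilon> js F (upd_coord t j s)) has_vector_derivative
          iter_pderiv \<epsilon> (j # js) F t) (at (t $ j) within {0..\<delta>})"
        by (rule has_vector_derivative_within_subset[OF differentiable_along_deriv[OF Cons.prems]])
           (use t param_box_mono[OF \<open>\<delta> \<le> \<epsilon>\<close>] \<open>\<delta> \<le> \<epsilon>\<close> in auto)
    qed (use IH t param_box_nth[OF t, of j] in auto)
    have "differentiable_along \<delta> (j # js) F"
      using IH der by (intro differentiable_along_ConsI) (auto intro: differentiableI_vector)
    moreover have "iter_pderiv \<delta> (j # js) F t = iter_pderiv \<epsilon> (j # js) F t" if "t \<in> param_box \<delta>" for t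
      using iter_pderiv_ConsI[OF \<open>0 < \<delta>\<close> that der[OF that]] .
    ultimately show ?case by blast
  qed simp
  then show "differentiable_along \<delta> js F"
    and "t \<in> param_box \<delta> \<Longrightarrow> iter_pderiv \<delta> js F t = iter_pderiv \<epsilon> js F t" by auto
qed

section \<open>Leibniz rule along a list of coordinates\<close>

text \<open>One entry for each set of positions sent to the left component. Equal pairs are kept
  with repetition, which replaces the binomial coefficients of the usual Leibniz rule.\<close>

primrec splits :: "'a list \<Rightarrow> ('a list \<times> 'a list) list" where
  "splits [] = [([], [])]"
| "splits (j # js) =
    map (\<lambda>(a, b). (j # a, b)) (splits js) @ map (\<lambda>(a, b). (a, j # b)) (splits js)"

lemma splits_subseq: "(a, b) \<in> set (splits js) \<Longrightarrow> subseq a js \<and> subseq b js"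
  by (induction js arbitrary: a b) auto

lemma has_vector_derivative_sum_list:
  assumes "\<And>x. x \<in> set xs \<Longrightarrow> (f x has_vector_derivative f' x) net"
  shows "((\<lambda>s. \<Sum>x\<leftarrow>xs. f x s) has_vector_derivative (\<Sum>x\<leftarrow>xs. f' x)) net"
  using assms by (induction xs) (auto intro!: has_vector_derivative_add)

text \<open>Leibniz rule along a list of directions, indexed by the ways of splitting the list into two
  complementary subsequences, so that no symmetry of higher derivatives is needed.\<close>

lemma iter_pderiv_mult:
  assumes "\<epsilon> > 0"
    and "\<And>a b. (a, b) \<in> set (splits js) \<Longrightarrow> differentiable_along \<epsilon> a F \<and> differentiable_along \<epsilon> b G"
    and "t \<in> param_box \<epsilon>"
  shows "iter_pderiv \<epsilon> js (\<lambda>t. F t * G t) t =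
    (\<Sum>(a, b)\<leftarrow>splits js. iter_pderiv \<epsilon> a F t * iter_pderiv \<epsilon> b G t)"
  using assms(2,3)
proof (induction js arbitrary: t)
  case (Cons j js)
  let ?S = "splits js"
  have sp: "differentiable_along \<epsilon> (j # a) F" "differentiable_along \<epsilon> (j # b) G"
    if "(a, b) \<in> set ?S" for a b
    using that Cons.prems(1)[of "j # a" b] Cons.prems(1)[of a "j # b"] by force+
  have IH: "iter_pderiv \<epsilon> js (\<lambda>t. F t * G t) t =
      (\<Sum>(a, b)\<leftarrow>?S. iter_pderiv \<epsilon> a F t * iter_pderiv \<epsilon> b G t)" if "t \<in> param_box \<epsilon>" for t
    by (rule Cons.IH[OF _ that]) (use sp differentiable_along_tail in blast)
  let ?I = "at (t $ j) within {0..\<epsilon>}"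
  have "((\<lambda>s. \<Sum>p\<leftarrow>?S. iter_pderiv \<epsilon> (fst p) F (upd_coord t j s) * iter_pderiv \<epsilon> (snd p) G (upd_coord t j s))
      has_vector_derivative
      (\<Sum>p\<leftarrow>?S. iter_pderiv \<epsilon> (fst p) F (upd_coord t j (t $ j)) * iter_pderiv \<epsilon> (j # snd p) G t +
          iter_pderiv \<epsilon> (j # fst p) F t * iter_pderiv \<epsilon> (snd p) G (upd_coord t j (t $ j)))) ?I"
    by (intro has_vector_derivative_sum_list has_vector_derivative_mult differentiable_along_deriv)
       (use sp Cons.prems(2) in auto)
  then have "((\<lambda>s. iter_pderiv \<epsilon> js (\<lambda>t. F t * G t) (upd_coord t j s)) has_vector_derivative
      (\<Sum>p\<leftarrow>?S. iter_pderiv \<epsilon> (fst p) F t * iter_pderiv \<epsilon> (j # snd p) G t +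
          iter_pderiv \<epsilon> (j # fst p) F t * iter_pderiv \<epsilon> (snd p) G t)) ?I"
    unfolding upd_coord_same by (rule has_vector_derivative_transform[rotated 2])
       (use IH Cons.prems(2) param_box_nth[OF Cons.prems(2), of j] in \<open>auto simp: case_prod_unfold\<close>)
  \<comment> \<open>The two summands of the product rule are the two halves of
    \<open>splits (j # js)\<close>, up to their order.\<close>
  from iter_pderiv_ConsI[OF assms(1) Cons.prems(2) this] show ?case
    by (simp add: case_prod_unfold comp_def sum_list_addf add.commute)
qed simp

section \<open>Iterated derivatives of functions with a parameter\<close>

text \<open>The derivative is a pointwise limit of measurable difference quotients. One sequence
  serves all \<open>w\<close>, and it exists at boundary points too because every point of a
  nondegenerate interval is a limit point of it.\<close>

lemma iter_pderiv_measurable: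
  assumes "\<epsilon> > 0"
    and "\<And>w. w \<in> space M \<Longrightarrow> differentiable_along \<epsilon> js (\<lambda>t. H t w)"
    and "\<And>t. t \<in> param_box \<epsilon> \<Longrightarrow> H t \<in> borel_measurable M"
    and "t \<in> param_box \<epsilon>"
  shows "(\<lambda>w. iter_pderiv \<epsilon> js (\<lambda>t. H t w) t) \<in> borel_measurable M"
  using assms(2,4)
proof (induction js arbitrary: t)
  case Nil
  then show ?case using assms(3) by simp
next
  case (Cons j js)
  have meas: "(\<lambda>w. iter_pderiv \<epsilon> js (\<lambda>t. H t w) t) \<in> borel_measurable M" if "t \<in> param_box \<epsilon>" for t
    using Cons.IH[OF differentiable_along_tail[OF Cons.prems(1)] that] by simp
  have "t $ j \<in> {0..\<epsilon>}" using Cons.prems(2) by (rule param_box_nth)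
  then have "t $ j islimpt {0..\<epsilon>}" using assms(1) by (simp add: islimpt_Icc)
  then obtain S where S: "\<And>i. S i \<in> {0..\<epsilon>} - {t $ j}" "S \<longlonglongrightarrow> t $ j"
    unfolding islimpt_sequential by blast
  show ?case
  proof (rule borel_measurable_LIMSEQ_metric)
    show "(\<lambda>w. (iter_pderiv \<epsilon> js (\<lambda>t. H t w) (upd_coord t j (S i)) - iter_pderiv \<epsilon> js (\<lambda>t. H t w) t)
        /\<^sub>R (S i - t $ j)) \<in> borel_measurable M" for i
      by (intro borel_measurable_scaleR borel_measurable_diff meas borel_measurable_const)
         (use S(1)[of i] Cons.prems(2) in auto)
    fix w assume "w \<in> space M"
    from differentiable_along_deriv[OF Cons.prems(1)[OF this] Cons.prems(2)]
    show "(\<lambda>i. (iter_pderiv \<epsilon> js (\<lambda>t. H t w) (upd_coord t j (S i)) - iter_pderiv \<epsilon> js (\<lambda>t. H t w) t)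
        /\<^sub>R (S i - t $ j)) \<longlonglongrightarrow> iter_pderiv \<epsilon> (j # js) (\<lambda>t. H t w) t"
      unfolding has_vector_derivative_iff_quotient tendsto_at_iff_sequentially comp_def
      using S by auto
  qed
qed

text \<open>The rightmost coordinate is differentiated first, so the intermediate derivatives belong
  to the suffixes of \<open>js\<close>. Each needs a majorant: the one for the tail makes the
  integrand integrable, the one for the full list dominates its difference quotients.\<close>

lemma iter_pderiv_integral:
  assumes "\<epsilon> > 0"
    and "\<And>w. w \<in> space M \<Longrightarrow> differentiable_along \<epsilon> js (\<lambda>t. H t w)"
    and meas: "\<And>t. t \<in> param_box \<epsilon> \<Longrightarrow> H t \<in> borel_measurable M"
    and "\<And>ks. suffix ks js \<Longrightarrow>
      \<exists>h. integrable M h \<and> (AE w in M. \<forall>t\<in>param_box \<epsilon>. cmod (iter_pderiv \<epsilon> ks (\<lambda>t. H t w) t) \<le> h w)"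
    and "t \<in> param_box \<epsilon>"
  shows "iter_pderiv \<epsilon> js (\<lambda>t. \<integral>w. H t w \<partial>M) t = (\<integral>w. iter_pderiv \<epsilon> js (\<lambda>t. H t w) t \<partial>M)"
  using assms(2,4,5)
proof (induction js arbitrary: t)
  case (Cons j js)
  have tail: "differentiable_along \<epsilon> js (\<lambda>t. H t w)" if "w \<in> space M" for w
    using differentiable_along_tail[OF Cons.prems(1)[OF that]] .
  have IH: "iter_pderiv \<epsilon> js (\<lambda>t. \<integral>w. H t w \<partial>M) t = (\<integral>w. iter_pderiv \<epsilon> js (\<lambda>t. H t w) t \<partial>M)"
    if "t \<in> param_box \<epsilon>" for t
    using Cons.IH[OF tail Cons.prems(2)[OF suffix_ConsI] that] by simp
  from Cons.prems(2)[of js] obtain h0 where h0: "integrable M h0"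
      "AE w in M. \<forall>t\<in>param_box \<epsilon>. cmod (iter_pderiv \<epsilon> js (\<lambda>t. H t w) t) \<le> h0 w"
    by (auto simp: suffix_Cons)
  from Cons.prems(2)[of "j # js"] obtain h where h: "integrable M h"
      "AE w in M. \<forall>t\<in>param_box \<epsilon>. cmod (iter_pderiv \<epsilon> (j # js) (\<lambda>t. H t w) t) \<le> h w"
    by auto
  have "((\<lambda>s. \<integral>w. iter_pderiv \<epsilon> js (\<lambda>t. H t w) (upd_coord t j s) \<partial>M) has_vector_derivative
      (\<integral>w. iter_pderiv \<epsilon> (j # js) (\<lambda>t. H t w) (upd_coord t j (t $ j)) \<partial>M)) (at (t $ j) within {0..\<epsilon>})"
  proof (rule has_vector_derivative_integral_dominated[where h = h
        and f' = "\<lambda>s w. iter_pderiv \<epsilon> (j # js) (\<lambda>t. H t w) (upd_coord t j s)"])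
    show "integrable M (\<lambda>w. iter_pderiv \<epsilon> js (\<lambda>t. H t w) (upd_coord t j s))" if s: "s \<in> {0..\<epsilon>}" for s
    proof (rule Bochner_Integration.integrable_bound[OF h0(1)])
      have u: "upd_coord t j s \<in> param_box \<epsilon>" using Cons.prems(3) s by simp
      show "(\<lambda>w. iter_pderiv \<epsilon> js (\<lambda>t. H t w) (upd_coord t j s)) \<in> borel_measurable M"
        by (rule iter_pderiv_measurable[OF assms(1) tail meas u])
      show "AE w in M. cmod (iter_pderiv \<epsilon> js (\<lambda>t. H t w) (upd_coord t j s)) \<le> norm (h0 w)"
        using h0(2) by eventually_elim (use u in fastforce)
    qed
    show "(\<lambda>w. iter_pderiv \<epsilon> (j # js) (\<lambda>t. H t w) (upd_coord t j (t $ j))) \<in> borel_measurable M"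
      unfolding upd_coord_same by (rule iter_pderiv_measurable[OF assms(1) Cons.prems(1) meas Cons.prems(3)])
    show "AE w in M. \<forall>s\<in>{0..\<epsilon>}. cmod (iter_pderiv \<epsilon> (j # js) (\<lambda>t. H t w) (upd_coord t j s)) \<le> h w"
      using h(2) by eventually_elim (use Cons.prems(3) in \<open>simp del: iter_pderiv.simps\<close>)
  qed (use assms(1) h(1) param_box_nth[OF Cons.prems(3), of j]
        differentiable_along_deriv_upd[OF Cons.prems(1) Cons.prems(3)] in
        \<open>simp_all del: iter_pderiv.simps\<close>)
  then have "((\<lambda>s. iter_pderiv \<epsilon> js (\<lambda>t. \<integral>w. H t w \<partial>M) (upd_coord t j s)) has_vector_derivative
      (\<integral>w. iter_pderiv \<epsilon> (j # js) (\<lambda>t. H t w) t \<partial>M)) (at (t $ j) within {0..\<epsilon>})"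
    unfolding upd_coord_same
    by (rule has_vector_derivative_transform[rotated 2])
       (use IH Cons.prems(3) param_box_nth[OF Cons.prems(3), of j] in auto)
  from iter_pderiv_ConsI[OF assms(1) Cons.prems(3) this] show ?case .
qed simp

subsection \<open>Multi-indices as sorted lists\<close>

lemma count_list_concat_replicate:
  "distinct js \<Longrightarrow>
    count_list (concat (map (\<lambda>j. replicate (\<nu> j) j) js)) k = (if k \<in> set js then \<nu> k else 0)"
proof (induction js)
  case (Cons j js)
  have "count_list (replicate m j) k = (if k = j then m else 0)" for m
    by (induction m) auto
  with Cons show ?case by auto
qed simp

lemma sorted_concat_replicate:
  "sorted js \<Longrightarrow> sorted (concat (map (\<lambda>j. replicate (\<nu> j) j) js))"
proof (induction js)
  case (Cons j js)
  have "sorted (replicate (\<nu> j) j)" by (simp add: sorted_replicate)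
  with Cons show ?case by (auto simp: sorted_append split: if_splits)
qed simp

lemma sorted_multi_coords: "sorted (multi_coords \<nu>)"
  by (simp add: multi_coords_def sorted_concat_replicate)

lemma count_list_multi_coords: "count_list (multi_coords \<nu>) = \<nu>"
  by (simp add: multi_coords_def count_list_concat_replicate fun_eq_iff)

lemma length_multi_coords: "length (multi_coords \<nu>) = multi_order \<nu>"
  using sum_count_set[of "multi_coords \<nu>" UNIV]
  by (simp add: multi_order_def count_list_multi_coords)

text \<open>A sorted list is determined by its multiset, so sorted lists and multi-indices
  correspond to each other.\<close>

lemma multi_coords_count_list:
  assumes "sorted js"
  shows "multi_coords (count_list js) = js"
proof -
  have "mset (multi_coords (count_list js)) = mset js"
    by (simp add: multiset_eq_iff count_mset count_list_multi_coords)
  then show ?thesis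
    using properties_for_sort[OF _ sorted_multi_coords] properties_for_sort[OF refl assms] by metis
qed

lemma subseq_sorted: "subseq a b \<Longrightarrow> sorted b \<Longrightarrow> sorted a"
proof (induction rule: list_emb.induct)
  case (list_emb_Cons2 x y xs ys)
  then have "set xs \<subseteq> set ys" by (metis set_nths_subset subseq_conv_nths)
  with list_emb_Cons2 show ?case by auto
qed auto

text \<open>Carries hypotheses stated for multi-indices over to the lists that arise as intermediate
  derivatives and as Leibniz factors.\<close>

lemma subseq_multi_coords:
  assumes "subseq js (multi_coords \<nu>)" "multi_order \<nu> \<le> n"
  obtains \<mu> where "js = multi_coords \<mu>" "multi_order \<mu> \<le> n"
proof
  show eq: "js = multi_coords (count_list js)"
    using multi_coords_count_list subseq_sorted[OF assms(1) sorted_multi_coords] by metis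
  then have "multi_order (count_list js) = length js" by (metis length_multi_coords)
  also have "\<dots> \<le> n"
    using list_emb_length[OF assms(1)] assms(2) by (simp add: length_multi_coords)
  finally show "multi_order (count_list js) \<le> n" .
qed

subsection \<open>Markov processes\<close>

lemma integral_Complex:
  assumes "integrable M f" "integrable M g"
  shows "integrable M (\<lambda>x. Complex (f x) (g x))"
    and "(\<integral>x. Complex (f x) (g x) \<partial>M) = Complex (\<integral>x. f x \<partial>M) (\<integral>x. g x \<partial>M)"
  using assms by (simp_all add: Complex_eq)

section \<open>Integration against a mixture of kernels\<close>

lemma integral_bind_bounded:
  fixes f :: "'b \<Rightarrow> complex"
  assumes M: "finite_measure M" "space M \<noteq> {}" and K: "K \<in> M \<rightarrow>\<^sub>M prob_algebra B"
    and f: "f \<in> borel_measurable B" and c: "\<And>x. cmod (f x) \<le> c"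
  shows "(\<integral>y. f y \<partial>(M \<bind> K)) = (\<integral>x. (\<integral>y. f y \<partial>K x) \<partial>M)"
    and "integrable M (\<lambda>x. \<integral>y. f y \<partial>K x)"
proof -
  have K'[measurable]: "K \<in> M \<rightarrow>\<^sub>M subprob_algebra B" by (rule measurable_prob_algebraD[OF K])
  have sets_bind: "sets (M \<bind> K) = sets B" by (rule sets_bind[OF sets_kernel[OF K'] M(2)])
  have Kx: "prob_space (K x)" "sets (K x) = sets B" if "x \<in> space M" for x
    using measurable_space[OF K that] by (auto simp: space_prob_algebra)
  have fin: "finite_measure (M \<bind> K)"
  proof
    have "emeasure (M \<bind> K) (space (M \<bind> K)) = (\<integral>\<^sup>+x. emeasure (K x) (space B) \<partial>M)"
      using emeasure_bind[OF M(2) K' sets.top] sets_eq_imp_space_eq[OF sets_bind] by simp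
    also have "\<dots> = (\<integral>\<^sup>+x. 1 \<partial>M)"
      by (rule nn_integral_cong) (metis Kx prob_space.emeasure_space_1 sets_eq_imp_space_eq)
    also have "\<dots> = emeasure M (space M)" by simp
    finally show "emeasure (M \<bind> K) (space (M \<bind> K)) \<noteq> \<infinity>"
      using finite_measure.emeasure_finite[OF M(1)] by (simp add: top.not_eq_extremum)
  qed
  have int_bind: "integrable (M \<bind> K) g" if "g \<in> borel_measurable B" "\<And>x. \<bar>g x\<bar> \<le> c" for g :: "_ \<Rightarrow> real" and c
    by (rule finite_measure.integrable_const_bound[OF fin, where B = c])
       (use that measurable_cong_sets[OF sets_bind refl] in auto)
  have int_K: "integrable (K x) g"
    if "x \<in> space M" "g \<in> borel_measurable B" "\<And>x. \<bar>g x\<bar> \<le> c" for g :: "_ \<Rightarrow> real" and c x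
    by (rule finite_measure.integrable_const_bound[OF prob_space.finite_measure[OF Kx(1)[OF that(1)]], where B = c])
       (use that measurable_cong_sets[OF Kx(2) refl] in auto)
  have nonneg: "(\<integral>y. g y \<partial>(M \<bind> K)) = (\<integral>x. (\<integral>y. g y \<partial>K x) \<partial>M)
      \<and> integrable M (\<lambda>x. \<integral>y. g y \<partial>K x)"
    if g[measurable]: "g \<in> borel_measurable B" and nn: "\<And>x. 0 \<le> g x" and c: "\<And>x. g x \<le> c"
    for g :: "_ \<Rightarrow> real" and c
  proof -
    have abs: "\<bar>g x\<bar> \<le> c" for x using nn c by simp
    have meas: "(\<lambda>x. \<integral>y. g y \<partial>K x) \<in> borel_measurable M"
      using measurable_compose[OF K' integral_measurable_subprob_algebra[OF g]] by simp
    have eq: "(\<integral>\<^sup>+y. g y \<partial>K x) = ennreal (\<integral>y. g y \<partial>K x)" if "x \<in> space M" for x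
      by (rule nn_integral_eq_integral[OF int_K[OF that g abs]]) (use nn in simp)
    have "ennreal (\<integral>y. g y \<partial>(M \<bind> K)) = (\<integral>\<^sup>+y. g y \<partial>(M \<bind> K))"
      by (rule nn_integral_eq_integral[symmetric, OF int_bind[OF g abs]]) (use nn in simp)
    also have "\<dots> = (\<integral>\<^sup>+x. \<integral>\<^sup>+y. g y \<partial>K x \<partial>M)"
      by (rule nn_integral_bind[OF _ K']) simp
    also have "\<dots> = (\<integral>\<^sup>+x. ennreal (\<integral>y. g y \<partial>K x) \<partial>M)"
      by (rule nn_integral_cong) (rule eq)
    finally have *: "(\<integral>\<^sup>+x. ennreal (\<integral>y. g y \<partial>K x) \<partial>M) = ennreal (\<integral>y. g y \<partial>(M \<bind> K))" ..
    have nn': "0 \<le> (\<integral>y. g y \<partial>K x)" for x using nn by simp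
    have int: "integrable M (\<lambda>x. \<integral>y. g y \<partial>K x)"
      by (rule integrableI_nonneg[OF meas]) (use nn' * in auto)
    moreover have "ennreal (\<integral>x. (\<integral>y. g y \<partial>K x) \<partial>M) = ennreal (\<integral>y. g y \<partial>(M \<bind> K))"
      using nn_integral_eq_integral[OF int] nn' * by simp
    ultimately show ?thesis using nn nn' by simp
  qed
  have real: "(\<integral>y. g y \<partial>(M \<bind> K)) = (\<integral>x. (\<integral>y. g y \<partial>K x) \<partial>M)
      \<and> integrable M (\<lambda>x. \<integral>y. g y \<partial>K x)"
    if g[measurable]: "g \<in> borel_measurable B" and c: "\<And>x. \<bar>g x\<bar> \<le> c" for g :: "_ \<Rightarrow> real" and c
  proof -
    have b: "0 \<le> g x + c" "g x + c \<le> 2 * c" "0 \<le> c" for x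
      using c[of x] by (auto simp: abs_le_iff)
    \<comment> \<open>Adding the bound \<open>c\<close> makes the integrand nonnegative. The
      constant is integrated separately and subtracted again, both integrals being finite.\<close>
    note 1 = nonneg[of "\<lambda>x. g x + c", OF _ b(1,2)] and 2 = nonneg[of "\<lambda>_. c" c]
    have eq: "(\<integral>y. g y \<partial>K x) = (\<integral>y. g y + c \<partial>K x) - (\<integral>y. c \<partial>K x)" if "x \<in> space M" for x
      using int_K[OF that g c] int_K[OF that, of "\<lambda>_. c" c] b(3) by simp
    have "(\<integral>x. (\<integral>y. g y \<partial>K x) \<partial>M) = (\<integral>x. (\<integral>y. g y + c \<partial>K x) - (\<integral>y. c \<partial>K x) \<partial>M)"
      by (rule Bochner_Integration.integral_cong) (use eq in auto)
    also have "\<dots> = (\<integral>y. g y + c \<partial>(M \<bind> K)) - (\<integral>y. c \<partial>(M \<bind> K))"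
      using 1 2 b(3) by (subst Bochner_Integration.integral_diff) auto
    also have "\<dots> = (\<integral>y. g y \<partial>(M \<bind> K))"
      using int_bind[OF g c] int_bind[of "\<lambda>_. c" c] b(3) by simp
    finally have "(\<integral>x. (\<integral>y. g y \<partial>K x) \<partial>M) = (\<integral>y. g y \<partial>(M \<bind> K))" .
    moreover have "integrable M (\<lambda>x. \<integral>y. g y \<partial>K x)"
    proof (subst Bochner_Integration.integrable_cong[OF refl eq])
      show "integrable M (\<lambda>x. (\<integral>y. g y + c \<partial>K x) - (\<integral>y. c \<partial>K x))"
        by (rule Bochner_Integration.integrable_diff) (use 1 2 b(3) in auto)
    qed
    ultimately show ?thesis by simp
  qed
  have Re: "\<bar>Re (f x)\<bar> \<le> c" and Im: "\<bar>Im (f x)\<bar> \<le> c" for x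
    using c[of x] abs_Re_le_cmod[of "f x"] abs_Im_le_cmod[of "f x"] by auto
  have mRe: "(\<lambda>x. Re (f x)) \<in> borel_measurable B" and mIm: "(\<lambda>x. Im (f x)) \<in> borel_measurable B"
    using f by simp_all
  note R = real[OF mRe Re] and I = real[OF mIm Im]
  have int_c: "(\<integral>y. f y \<partial>L) = Complex (\<integral>y. Re (f y) \<partial>L) (\<integral>y. Im (f y) \<partial>L)"
    if "integrable L (\<lambda>x. Re (f x))" "integrable L (\<lambda>x. Im (f x))" for L
    using integral_Complex(2)[OF that] by simp
  have eq: "(\<integral>y. f y \<partial>K x) = Complex (\<integral>y. Re (f y) \<partial>K x) (\<integral>y. Im (f y) \<partial>K x)"
    if "x \<in> space M" for x
    by (rule int_c[OF int_K[OF that mRe Re] int_K[OF that mIm Im]])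
  show "integrable M (\<lambda>x. \<integral>y. f y \<partial>K x)"
  proof (subst Bochner_Integration.integrable_cong[OF refl eq])
    show "integrable M (\<lambda>x. Complex (\<integral>y. Re (f y) \<partial>K x) (\<integral>y. Im (f y) \<partial>K x))"
      by (rule integral_Complex(1)[OF conjunct2[OF R] conjunct2[OF I]])
  qed
  have "(\<integral>x. (\<integral>y. f y \<partial>K x) \<partial>M)
      = (\<integral>x. Complex (\<integral>y. Re (f y) \<partial>K x) (\<integral>y. Im (f y) \<partial>K x) \<partial>M)"
    by (rule Bochner_Integration.integral_cong[OF refl eq])
  also have "\<dots> = Complex (\<integral>x. (\<integral>y. Re (f y) \<partial>K x) \<partial>M) (\<integral>x. (\<integral>y. Im (f y) \<partial>K x) \<partial>M)"
    by (rule integral_Complex(2)[OF conjunct2[OF R] conjunct2[OF I]])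
  also have "\<dots> = (\<integral>y. f y \<partial>(M \<bind> K))"
    unfolding int_c[OF int_bind[OF mRe Re] int_bind[OF mIm Im]]
    using conjunct1[OF R] conjunct1[OF I] by (simp only:)
  finally show "(\<integral>y. f y \<partial>(M \<bind> K)) = (\<integral>x. (\<integral>y. f y \<partial>K x) \<partial>M)" ..
qed

section \<open>Canonical filtration and conditional expectations\<close>

lemma space_canonical_filtration [simp]: "space (canonical_filtration M X t) = space M"
  unfolding canonical_filtration_def by (rule space_measure_of) auto

lemma sets_canonical_filtration:
  "sets (canonical_filtration M X t) = sigma_sets (space M)
    {X u -` B \<inter> space M | u B. 0 \<le> u \<and> u \<le> t \<and> B \<in> sets borel}"
  unfolding canonical_filtration_def by (rule sets_measure_of) auto

lemma subalgebra_canonical_filtration: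
  assumes "\<And>u. 0 \<le> u \<Longrightarrow> X u \<in> M \<rightarrow>\<^sub>M borel"
  shows "subalgebra M (canonical_filtration M X t)"
  unfolding subalgebra_def sets_canonical_filtration
  by (auto intro!: sets.sigma_sets_subset measurable_sets[OF assms])

lemma canonical_filtration_mono:
  "s \<le> t \<Longrightarrow> sets (canonical_filtration M X s) \<subseteq> sets (canonical_filtration M X t)"
  unfolding sets_canonical_filtration by (rule sigma_sets_mono') force

lemma measurable_canonical_filtration:
  assumes "0 \<le> t"
  shows "X t \<in> canonical_filtration M X t \<rightarrow>\<^sub>M borel"
  using assms by (auto simp: measurable_def sets_canonical_filtration)

lemma (in prob_space) sigma_finite_subalgebraI:
  "subalgebra M F \<Longrightarrow> sigma_finite_subalgebra M F"
  by (intro finite_measure_subalgebra_is_sigma_finite)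
     (simp add: finite_measure_subalgebra_def finite_measure_subalgebra_axioms_def finite_measure_axioms)

text \<open>\<open>complex_cond_exp\<close> is assembled from two real conditional expectations, so
  the identity of complex set integrals is split into real and imaginary parts and the real
  characterization is used twice.\<close>

lemma (in prob_space) complex_cond_exp_charact:
  assumes G: "subalgebra M G" and Y: "integrable M Y" and Z: "integrable M Z" "Z \<in> borel_measurable G"
    and eq: "\<And>A. A \<in> sets G \<Longrightarrow> (\<integral>w\<in>A. Y w \<partial>M) = (\<integral>w\<in>A. Z w \<partial>M)"
  shows "AE w in M. complex_cond_exp M G Y w = Z w"
proof -
  interpret sigma_finite_subalgebra M G by (rule sigma_finite_subalgebraI[OF G])
  have int: "integrable M (\<lambda>w. indicat_real A w *\<^sub>R V w)" if "A \<in> sets G" "integrable M V"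
    for A and V :: "'a \<Rightarrow> complex"
    using G that by (intro integrable_mult_indicator) (auto simp: subalgebra_def)
  have "AE w in M. real_cond_exp M G (\<lambda>v. Re (Y v)) w = Re (Z w)"
  proof (rule real_cond_exp_charact)
    fix A assume A: "A \<in> sets G"
    show "(\<integral>w\<in>A. Re (Y w) \<partial>M) = (\<integral>w\<in>A. Re (Z w) \<partial>M)"
      using arg_cong[OF eq[OF A], of Re] integral_Re[OF int[OF A Y]] integral_Re[OF int[OF A Z(1)]]
      by (simp add: set_lebesgue_integral_def)
  qed (use Y Z in auto)
  moreover have "AE w in M. real_cond_exp M G (\<lambda>v. Im (Y v)) w = Im (Z w)"
  proof (rule real_cond_exp_charact)
    fix A assume A: "A \<in> sets G"
    show "(\<integral>w\<in>A. Im (Y w) \<partial>M) = (\<integral>w\<in>A. Im (Z w) \<partial>M)"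
      using arg_cong[OF eq[OF A], of Im] integral_Im[OF int[OF A Y]] integral_Im[OF int[OF A Z(1)]]
      by (simp add: set_lebesgue_integral_def)
  qed (use Y Z in auto)
  ultimately show ?thesis
    by eventually_elim (simp add: complex_cond_exp_def complex_eq_iff)
qed

text \<open>The Markov property, which concerns indicators of Borel sets, says that on
  \<open>A\<close> the law of \<open>X t\<close> is the mixture of the kernels started from
  \<open>X s\<close>. Equality of these two measures yields equality of integrals for all bounded
  Borel functions at once.\<close>

lemma markov_process_integral:
  fixes f :: "'x::topological_space \<Rightarrow> complex"
  assumes "markov_process M P X" "0 \<le> s" "s \<le> t"
    and K: "P (t - s) \<in> borel \<rightarrow>\<^sub>M prob_algebra borel"
    and A: "A \<in> sets (canonical_filtration M X s)"
    and f: "f \<in> borel_measurable borel" "\<And>x. cmod (f x) \<le> c"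
  shows "(\<integral>w\<in>A. f (X t w) \<partial>M) = (\<integral>w\<in>A. (\<integral>y. f y \<partial>P (t - s) (X s w)) \<partial>M)"
proof -
  interpret prob_space M using assms(1) by (simp add: markov_process_def)
  have X: "X u \<in> M \<rightarrow>\<^sub>M borel" if "0 \<le> u" for u using assms(1) that by (simp add: markov_process_def)
  have [measurable]: "X s \<in> M \<rightarrow>\<^sub>M borel" "X t \<in> M \<rightarrow>\<^sub>M borel" using X assms by auto
  let ?F = "canonical_filtration M X s"
  have sub: "subalgebra M ?F" by (rule subalgebra_canonical_filtration[OF X])
  interpret F: sigma_finite_subalgebra M ?F by (rule sigma_finite_subalgebraI[OF sub])
  have AM[measurable]: "A \<in> sets M" using A sub by (auto simp: subalgebra_def)
  define N where "N = density M (\<lambda>w. ennreal (indicat_real A w))"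
  have spN [simp]: "space N = space M" and seN [measurable_cong]: "sets N = sets M" by (auto simp: N_def)
  have finN: "finite_measure N"
    by standard (simp add: N_def emeasure_density ennreal_indicator)
  let ?K = "\<lambda>w. P (t - s) (X s w)"
  have K'[measurable]: "?K \<in> N \<rightarrow>\<^sub>M prob_algebra borel"
    by (rule measurable_compose[OF _ K]) simp
  have K''[measurable]: "?K \<in> N \<rightarrow>\<^sub>M subprob_algebra borel" "?K \<in> M \<rightarrow>\<^sub>M subprob_algebra borel"
    using measurable_prob_algebraD[OF K'] measurable_cong_sets[OF seN refl] by auto
  have prob: "prob_space (?K w)" "sets (?K w) = sets borel" if "w \<in> space M" for w
    using measurable_space[OF K', of w] that by (auto simp: space_prob_algebra)
  have ne: "space N \<noteq> {}" using not_empty by simp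
  have eq: "distr N borel (X t) = N \<bind> ?K"
  proof (rule measure_eqI)
    have *: "sets (N \<bind> ?K) = sets borel" by (rule sets_bind[OF sets_kernel[OF K''(1)] ne])
    show "sets (distr N borel (X t)) = sets (N \<bind> ?K)" by (simp add: *)
    fix B assume "B \<in> sets (distr N borel (X t))"
    then have B[measurable]: "B \<in> sets borel" by simp
    let ?XB = "X t -` B \<inter> space M"
    have XB[measurable]: "?XB \<in> sets M" by measurable
    have mP: "(\<lambda>w. measure (?K w) B) \<in> borel_measurable M"
      by (rule measurable_compose[OF K''(2) measurable_measure_subprob_algebra[OF B]])
    have le1: "measure (?K w) B \<le> 1" if "w \<in> space M" for w
      using prob_space.prob_le_1[OF prob(1)[OF that]] .
    have int: "integrable M (\<lambda>w. indicat_real A w * measure (?K w) B)"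
      by (rule integrable_const_bound[where B = 1])
         (use mP le1 in \<open>auto simp: indicator_def intro!: AE_I2 borel_measurable_times borel_measurable_indicator\<close>)
    have "emeasure (distr N borel (X t)) B = emeasure M (A \<inter> ?XB)"
      by (simp add: emeasure_distr N_def emeasure_density ennreal_indicator flip: indicator_inter_arith)
    also have "\<dots> = ennreal (\<integral>w. indicat_real A w * indicat_real ?XB w \<partial>M)"
      by (simp add: emeasure_eq_measure flip: indicator_inter_arith)
    \<comment> \<open>Here \<open>A\<close> must lie in the past of \<open>s\<close>: its indicator
      is then a factor that may stand in front of the conditional expectation.\<close>
    also have "(\<integral>w. indicat_real A w * indicat_real ?XB w \<partial>M)
        = (\<integral>w. indicat_real A w * real_cond_exp M ?F (indicat_real ?XB) w \<partial>M)"
      using A by (intro F.real_cond_exp_intg(2)[symmetric]) (auto simp: less_top[symmetric] simp flip: indicator_inter_arith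
          intro!: integrable_real_indicator)
    also have "\<dots> = (\<integral>w. indicat_real A w * measure (?K w) B \<partial>M)"
    proof (rule integral_cong_AE)
      have "AE w in M. real_cond_exp M ?F (indicat_real ?XB) w = measure (?K w) B"
        using assms(1-3) B by (auto simp: markov_process_def)
      then show "AE w in M. indicat_real A w * real_cond_exp M ?F (indicat_real ?XB) w
          = indicat_real A w * measure (?K w) B"
        by eventually_elim simp
    qed (use mP in auto)
    also have "ennreal \<dots> = (\<integral>\<^sup>+w. ennreal (indicat_real A w * measure (?K w) B) \<partial>M)"
      by (rule nn_integral_eq_integral[symmetric, OF int]) simp
    also have "\<dots> = (\<integral>\<^sup>+w. ennreal (indicat_real A w) * emeasure (?K w) B \<partial>M)"
    proof (rule nn_integral_cong)
      fix w assume "w \<in> space M"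
      then interpret K: prob_space "?K w" by (rule prob)
      show "ennreal (indicat_real A w * measure (?K w) B) = ennreal (indicat_real A w) * emeasure (?K w) B"
        by (simp add: K.emeasure_eq_measure ennreal_mult)
    qed
    also have "\<dots> = (\<integral>\<^sup>+w. emeasure (?K w) B \<partial>N)"
      unfolding N_def by (rule nn_integral_density[symmetric]) auto
    also have "\<dots> = emeasure (N \<bind> ?K) B"
      by (rule emeasure_bind[symmetric, OF ne K''(1) B])
    finally show "emeasure (distr N borel (X t)) B = emeasure (N \<bind> ?K) B" .
  qed
  note b = integral_bind_bounded[OF finN ne K' f]
  have "(\<integral>w\<in>A. f (X t w) \<partial>M) = (\<integral>w. f (X t w) \<partial>N)"
    unfolding N_def set_lebesgue_integral_def using f(1) by (intro integral_density[symmetric]) auto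
  also have "\<dots> = (\<integral>y. f y \<partial>(N \<bind> ?K))"
    using f(1) by (subst eq[symmetric], subst integral_distr) auto
  also have "\<dots> = (\<integral>w. (\<integral>y. f y \<partial>?K w) \<partial>N)" by (rule b)
  also have "\<dots> = (\<integral>w\<in>A. (\<integral>y. f y \<partial>?K w) \<partial>M)"
    using borel_measurable_integrable[OF b(2)] measurable_cong_sets[OF seN refl]
    unfolding N_def set_lebesgue_integral_def by (intro integral_density) auto
  finally show ?thesis .
qed

subsection \<open>Appell characters\<close>

lemma dir_cont_diff_differentiable_along:
  "dir_cont_diff \<epsilon> \<zeta> n f \<Longrightarrow> multi_order \<nu> \<le> n \<Longrightarrow>
    differentiable_along \<epsilon> (multi_coords \<nu>) (\<lambda>p. f (dir_point \<zeta> p))"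
  by (simp add: dir_cont_diff_def differentiable_along_def dir_deriv_exists_def)

lemma dir_cont_diff_bounded:
  assumes "dir_cont_diff \<epsilon> \<zeta> n f" "multi_order \<nu> \<le> n"
  obtains C where "\<And>t. t \<in> param_box \<epsilon> \<Longrightarrow>
    cmod (iter_pderiv \<epsilon> (multi_coords \<nu>) (\<lambda>p. f (dir_point \<zeta> p)) t) \<le> C"
proof -
  have "continuous_on (param_box \<epsilon>) (dir_deriv \<epsilon> \<zeta> \<nu> f)"
    using assms by (simp add: dir_cont_diff_def)
  then have "bounded (dir_deriv \<epsilon> \<zeta> \<nu> f ` param_box \<epsilon>)"
    using compact_continuous_image compact_imp_bounded compact_param_box by blast
  then show thesis using that by (auto simp: bounded_iff dir_deriv_def)
qed

lemma sum_list_dominated: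
  assumes "\<And>p. p \<in> set ps \<Longrightarrow>
    \<exists>h. integrable M h \<and> (AE w in M. \<forall>t\<in>B. cmod (F p t w) \<le> h w)"
  shows "\<exists>h. integrable M h \<and> (AE w in M. \<forall>t\<in>B. cmod (\<Sum>p\<leftarrow>ps. F p t w) \<le> h w)"
  using assms
proof (induction ps)
  case Nil
  then show ?case by (intro exI[of _ "\<lambda>_. 0"]) simp
next
  case (Cons p ps)
  from Cons.prems[of p] obtain h where h: "integrable M h" "AE w in M. \<forall>t\<in>B. cmod (F p t w) \<le> h w"
    by auto
  from Cons.IH[OF Cons.prems] obtain k where k: "integrable M k"
      "AE w in M. \<forall>t\<in>B. cmod (\<Sum>p\<leftarrow>ps. F p t w) \<le> k w"
    by auto
  have "AE w in M. \<forall>t\<in>B. cmod (\<Sum>p\<leftarrow>p # ps. F p t w) \<le> h w + k w"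
    using h(2) k(2) by eventually_elim (auto intro!: norm_triangle_mono)
  then show ?case using h(1) k(1) by (intro exI[of _ "\<lambda>w. h w + k w"]) auto
qed

lemma deriv_sup_dominated:
  assumes X: "X \<in> M \<rightarrow>\<^sub>M borel"
    and sup: "deriv_sup \<phi> \<epsilon> \<zeta> \<nu> \<in> borel_measurable borel"
    and fin: "(\<integral>\<^sup>+x. deriv_sup \<phi> \<epsilon> \<zeta> \<nu> x \<partial>distr M borel X) < \<infinity>"
  shows "\<exists>h. integrable M h \<and>
    (AE w in M. \<forall>t\<in>param_box \<epsilon>. cmod (dir_deriv \<epsilon> \<zeta> \<nu> (\<lambda>l. \<phi> l (X w)) t) \<le> h w)"
proof (intro exI conjI)
  let ?D = "deriv_sup \<phi> \<epsilon> \<zeta> \<nu>"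
  \<comment> \<open>Where the supremum is infinite \<open>enn2real\<close> gives 0, so
    \<open>?h\<close> is a majorant only off that set, which is null because the integral is
    finite.\<close>
  let ?h = "\<lambda>w. enn2real (?D (X w))"
  have [measurable]: "(\<lambda>w. ?D (X w)) \<in> borel_measurable M"
    using measurable_compose[OF X sup] .
  have fin': "(\<integral>\<^sup>+w. ?D (X w) \<partial>M) < \<infinity>"
    using fin sup by (simp add: nn_integral_distr[OF X])
  then have "(\<integral>\<^sup>+w. ?D (X w) \<partial>M) \<noteq> \<infinity>" by simp
  then have AE: "AE w in M. ?D (X w) \<noteq> \<infinity>" by (intro nn_integral_PInf_AE) auto
  show "integrable M ?h"
  proof (rule integrableI_nonneg)
    have "(\<integral>\<^sup>+w. ennreal (?h w) \<partial>M) \<le> (\<integral>\<^sup>+w. ?D (X w) \<partial>M)"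
      by (intro nn_integral_mono) (simp add: ennreal_enn2real_if)
    then show "(\<integral>\<^sup>+w. ennreal (?h w) \<partial>M) < \<infinity>" using fin' by (rule le_less_trans)
  qed auto
  show "AE w in M. \<forall>t\<in>param_box \<epsilon>. cmod (dir_deriv \<epsilon> \<zeta> \<nu> (\<lambda>l. \<phi> l (X w)) t) \<le> ?h w"
    using AE
  proof eventually_elim
    case (elim w)
    have "cmod (dir_deriv \<epsilon> \<zeta> \<nu> (\<lambda>l. \<phi> l (X w)) t) \<le> ?h w" if "t \<in> param_box \<epsilon>" for t
    proof -
      from that have "ennreal (cmod (dir_deriv \<epsilon> \<zeta> \<nu> (\<lambda>l. \<phi> l (X w)) t)) \<le> ?D (X w)"
        unfolding deriv_sup_def by (intro SUP_upper)
      then have "ennreal (cmod (dir_deriv \<epsilon> \<zeta> \<nu> (\<lambda>l. \<phi> l (X w)) t)) \<le> ennreal (?h w)"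
        using elim by (simp add: less_top)
      then show ?thesis by (simp add: ennreal_le_iff)
    qed
    then show ?case by blast
  qed
qed

text \<open>In each Leibniz term the \<phi> factor has an integrable majorant, and the factor from
  \<open>g\<close> does not depend on \<open>w\<close> and is bounded by a constant on the box. The
  term is thus majorized by an integrable function, and there are finitely many terms.\<close>

lemma iter_pderiv_mult_dominated:
  assumes "\<epsilon> > 0"
    and \<phi>: "\<And>\<mu> x. multi_order \<mu> \<le> n \<Longrightarrow>
      differentiable_along \<epsilon> (multi_coords \<mu>) (\<lambda>p. \<phi> (dir_point \<zeta> p) x)"
    and \<phi>_dom: "\<And>\<mu>. multi_order \<mu> \<le> n \<Longrightarrow> \<exists>h. integrable M h \<and>
      (AE w in M. \<forall>t\<in>param_box \<epsilon>.
        cmod (iter_pderiv \<epsilon> (multi_coords \<mu>) (\<lambda>p. \<phi> (dir_point \<zeta> p) (X w)) t) \<le> h w)"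
    and g: "\<And>\<mu>. multi_order \<mu> \<le> n \<Longrightarrow> differentiable_along \<epsilon> (multi_coords \<mu>) g"
    and g_bdd: "\<And>\<mu>. multi_order \<mu> \<le> n \<Longrightarrow>
      \<exists>C. \<forall>t\<in>param_box \<epsilon>. cmod (iter_pderiv \<epsilon> (multi_coords \<mu>) g t) \<le> C"
    and ks: "subseq ks (multi_coords \<nu>)" "multi_order \<nu> \<le> n"
  shows "\<exists>h. integrable M h \<and> (AE w in M. \<forall>t\<in>param_box \<epsilon>.
    cmod (iter_pderiv \<epsilon> ks (\<lambda>p. \<phi> (dir_point \<zeta> p) (X w) * g p) t) \<le> h w)"
proof -
  have sub: "\<exists>\<mu>. a = multi_coords \<mu> \<and> multi_order \<mu> \<le> n" if "subseq a ks" for a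
    using subseq_multi_coords[OF subseq_order.trans[OF that ks(1)] ks(2)] by metis
  have diff: "differentiable_along \<epsilon> a (\<lambda>p. \<phi> (dir_point \<zeta> p) x)" "differentiable_along \<epsilon> b g"
    if "(a, b) \<in> set (splits ks)" for a b x
    using sub splits_subseq[OF that] \<phi> g by blast+
  have "\<exists>h. integrable M h \<and> (AE w in M. \<forall>t\<in>param_box \<epsilon>.
      cmod (\<Sum>p\<leftarrow>splits ks. iter_pderiv \<epsilon> (fst p) (\<lambda>q. \<phi> (dir_point \<zeta> q) (X w)) t
        * iter_pderiv \<epsilon> (snd p) g t) \<le> h w)"
  proof (rule sum_list_dominated)
    fix p assume "p \<in> set (splits ks)"
    then have "subseq (fst p) ks" "subseq (snd p) ks" using splits_subseq[of "fst p" "snd p" ks] by auto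
    then obtain \<mu> \<kappa> where \<mu>: "fst p = multi_coords \<mu>" "multi_order \<mu> \<le> n"
      and \<kappa>: "snd p = multi_coords \<kappa>" "multi_order \<kappa> \<le> n"
      using sub by metis
    obtain h where h: "integrable M h" "AE w in M. \<forall>t\<in>param_box \<epsilon>.
        cmod (iter_pderiv \<epsilon> (fst p) (\<lambda>q. \<phi> (dir_point \<zeta> q) (X w)) t) \<le> h w"
      using \<phi>_dom[OF \<mu>(2)] \<mu>(1) by auto
    obtain C where C: "\<And>t. t \<in> param_box \<epsilon> \<Longrightarrow> cmod (iter_pderiv \<epsilon> (snd p) g t) \<le> C"
      using g_bdd[OF \<kappa>(2)] \<kappa>(1) by auto
    have "AE w in M. \<forall>t\<in>param_box \<epsilon>. cmod (iter_pderiv \<epsilon> (fst p) (\<lambda>q. \<phi> (dir_point \<zeta> q) (X w)) t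
        * iter_pderiv \<epsilon> (snd p) g t) \<le> h w * C"
      using h(2)
      by eventually_elim (auto simp: norm_mult intro!: mult_mono' C)
    then show "\<exists>h. integrable M h \<and> (AE w in M. \<forall>t\<in>param_box \<epsilon>.
        cmod (iter_pderiv \<epsilon> (fst p) (\<lambda>q. \<phi> (dir_point \<zeta> q) (X w)) t * iter_pderiv \<epsilon> (snd p) g t) \<le> h w)"
      using h(1) by (intro exI[of _ "\<lambda>w. h w * C"]) auto
  qed
  then show ?thesis
    by (simp add: iter_pderiv_mult[OF assms(1) conjI[OF diff]] case_prod_unfold)
qed

theorem theorem4p44:
  fixes Xhat :: "(real, 'n::{finite,linorder}) vec set"
    and \<phi> :: "(real, 'n) vec \<Rightarrow> 'x::{second_countable_topology, t2_space} \<Rightarrow> complex"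
    and e :: 'x
    and \<zeta> :: "'n \<Rightarrow> (real, 'n) vec"
    and \<epsilon> :: real
    and n :: nat
    and P :: "real \<Rightarrow> 'x \<Rightarrow> 'x measure"
    and \<psi> :: "(real, 'n) vec \<Rightarrow> complex"
    and M :: "'w measure"
    and X :: "real \<Rightarrow> 'w \<Rightarrow> 'x"
    and \<nu> :: "'n \<Rightarrow> nat"
  assumes "differentiable_integral_transform Xhat \<phi> e \<zeta> \<epsilon>"
    and "n \<ge> 1"
    and "related_semigroup Xhat \<phi> e P"
    and "negative_definite_function_of Xhat \<phi> e P \<psi>"
    and "appell_setting \<phi> \<epsilon> \<zeta> n P \<psi>"
    and "markov_process M P X"
    and "derivs_sup_integrable Xhat \<phi> \<zeta> n M X"
    and "multi_order \<nu> \<le> n"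
  shows "martingale M (canonical_filtration M X) (\<lambda>t w. appell_character \<phi> \<epsilon> \<zeta> \<psi> \<nu> t (X t w))"
proof -
  interpret differentiable_integral_transform Xhat \<phi> e \<zeta> \<epsilon> by fact
  interpret prob_space M using assms(6) by (simp add: markov_process_def)
  have X [measurable]: "X t \<in> M \<rightarrow>\<^sub>M borel" if "0 \<le> t" for t
    using assms(6) that by (simp add: markov_process_def)
  have sub: "subalgebra M (canonical_filtration M X t)" for t
    by (rule subalgebra_canonical_filtration[OF X])
  have \<phi>_meas: "\<phi> l \<in> borel_measurable borel" if "l \<in> Xhat" for l
    using \<phi>_bounded_continuous[OF that]
    by (auto simp: bounded_continuous_def intro: borel_measurable_continuous_onI)
  from assms(7) obtain \<epsilon>' where "\<epsilon>' > 0"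
    and ex': "\<And>\<mu> x. multi_order \<mu> \<le> n \<Longrightarrow>
      differentiable_along \<epsilon>' (multi_coords \<mu>) (\<lambda>p. \<phi> (dir_point \<zeta> p) x)"
    and sup: "\<And>\<mu>. multi_order \<mu> \<le> n \<Longrightarrow> deriv_sup \<phi> \<epsilon>' \<zeta> \<mu> \<in> borel_measurable borel"
      "\<And>\<mu> t. multi_order \<mu> \<le> n \<Longrightarrow> 0 \<le> t \<Longrightarrow>
        (\<integral>\<^sup>+x. deriv_sup \<phi> \<epsilon>' \<zeta> \<mu> x \<partial>distr M borel (X t)) < \<infinity>"
    unfolding derivs_sup_integrable_def differentiable_along_def dir_deriv_exists_def by metis
  \<comment> \<open>On this box both sources are available: differentiability of the Appell
    functions from side \<epsilon>, and integrable suprema from side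
    \<open>\<epsilon>'\<close>.\<close>
  define \<delta> where "\<delta> = min \<epsilon> \<epsilon>'"
  have \<delta>: "0 < \<delta>" "\<delta> \<le> \<epsilon>" "\<delta> \<le> \<epsilon>'" using \<open>\<epsilon>' > 0\<close> \<epsilon>_pos by (auto simp: \<delta>_def)
  have box: "dir_point \<zeta> p \<in> Xhat" if "p \<in> param_box \<delta>" for p
    using dir_point_in param_box_mono[OF \<delta>(2)] that by blast
  have zero: "0 \<in> param_box \<delta>" "0 \<in> param_box \<epsilon>" using \<delta>(1) \<epsilon>_pos by (auto intro: zero_in_param_box)

  define G where "G t x p = \<phi> (dir_point \<zeta> p) x * exp (complex_of_real t * \<psi> (dir_point \<zeta> p))" for t x p
  define g where "g t = G t e" for t
  \<comment> \<open>Confined to the box because \<open>dir_point\<close> may leave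
    \<open>Xhat\<close> elsewhere, where the normalization at \<open>e\<close> is not known.
    \<open>iter_pderiv_cong\<close> needs no more than this.\<close>
  have G_eq: "G t x p = \<phi> (dir_point \<zeta> p) x * g t p" if "p \<in> param_box \<delta>" for t x p
    using \<phi>_e[OF box[OF that]] by (simp add: G_def g_def)
  have dcd: "dir_cont_diff \<epsilon> \<zeta> n (\<lambda>l. \<phi> l x * exp (complex_of_real t * \<psi> l))" if "0 \<le> t" for t x
    using assms(5) that by (auto simp: appell_setting_def)
  have G_\<epsilon>: "differentiable_along \<epsilon> (multi_coords \<mu>) (G t x)" if "0 \<le> t" "multi_order \<mu> \<le> n" for t x \<mu>
    using dir_cont_diff_differentiable_along[OF dcd that(2)] that(1) unfolding G_def .
  note G_\<delta> = iter_pderiv_restrict[OF G_\<epsilon> \<delta>(1,2)]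
  note \<phi>_\<delta> = iter_pderiv_restrict[OF ex' \<delta>(1,3)]
  have \<phi>_dom: "\<exists>h. integrable M h \<and> (AE w in M. \<forall>p\<in>param_box \<delta>.
      cmod (iter_pderiv \<delta> (multi_coords \<mu>) (\<lambda>p. \<phi> (dir_point \<zeta> p) (X t w)) p) \<le> h w)"
    if "multi_order \<mu> \<le> n" "0 \<le> t" for \<mu> t
  proof -
    from deriv_sup_dominated[OF X sup, OF that(2) that(1) that]
    obtain h where h: "integrable M h" "AE w in M. \<forall>p\<in>param_box \<epsilon>'.
        cmod (iter_pderiv \<epsilon>' (multi_coords \<mu>) (\<lambda>p. \<phi> (dir_point \<zeta> p) (X t w)) p) \<le> h w"
      unfolding dir_deriv_def by auto
    from h(2) have "AE w in M. \<forall>p\<in>param_box \<delta>.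
        cmod (iter_pderiv \<delta> (multi_coords \<mu>) (\<lambda>p. \<phi> (dir_point \<zeta> p) (X t w)) p) \<le> h w"
      by eventually_elim (use \<phi>_\<delta>(2)[OF that(1)] param_box_mono[OF \<delta>(3)] in auto)
    with h(1) show ?thesis by blast
  qed
  have g_bdd: "\<exists>C. \<forall>p\<in>param_box \<delta>. cmod (iter_pderiv \<delta> (multi_coords \<mu>) (g t) p) \<le> C"
    if \<mu>: "multi_order \<mu> \<le> n" and t: "0 \<le> t" for \<mu> t
  proof -
    obtain C where C: "\<And>p. p \<in> param_box \<epsilon> \<Longrightarrow> cmod (iter_pderiv \<epsilon> (multi_coords \<mu>) (g t) p) \<le> C"
      using dir_cont_diff_bounded[OF dcd[OF t, of e] \<mu>] unfolding g_def G_def by blast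
    show ?thesis
      using C G_\<delta>(2)[OF t \<mu>, of _ e] param_box_mono[OF \<delta>(2)] by (auto simp: g_def)
  qed
  \<comment> \<open>Allowing all subsequences covers the suffixes that
    \<open>iter_pderiv_integral\<close> asks for.\<close>
  have G_dom: "\<exists>h. integrable M h \<and> (AE w in M. \<forall>p\<in>param_box \<delta>.
      cmod (iter_pderiv \<delta> ks (G t (X t w)) p) \<le> h w)"
    if "subseq ks (multi_coords \<nu>)" "0 \<le> t" for ks t
  proof -
    have "\<exists>h. integrable M h \<and> (AE w in M. \<forall>p\<in>param_box \<delta>.
        cmod (iter_pderiv \<delta> ks (\<lambda>p. \<phi> (dir_point \<zeta> p) (X t w) * g t p) p) \<le> h w)"
      by (rule iter_pderiv_mult_dominated[where X = "X t" and \<phi> = \<phi>, OF \<delta>(1) \<phi>_\<delta>(1) \<phi>_dom[OF _ that(2)] _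
            g_bdd[OF _ that(2)] that(1) assms(8)])
         (use G_\<delta>(1)[OF that(2)] in \<open>auto simp: g_def\<close>)
    then show ?thesis by (simp add: iter_pderiv_cong[OF G_eq])
  qed
  have G_meas: "(\<lambda>x. G t x p) \<in> borel_measurable borel" if "dir_point \<zeta> p \<in> Xhat" for t p
    using \<phi>_meas[OF that] unfolding G_def by measurable

  let ?L = "multi_coords \<nu>"
  define R where "R t x = iter_pderiv \<epsilon> ?L (G t x) 0" for t x
  have appell: "appell_character \<phi> \<epsilon> \<zeta> \<psi> \<nu> t x = \<i> ^ multi_order \<nu> * R t x" for t x
    by (simp add: appell_character_def dir_deriv_def R_def G_def[abs_def])
  have R_\<delta>: "R t x = iter_pderiv \<delta> ?L (G t x) 0" if "0 \<le> t" for t x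
    using G_\<delta>(2)[OF that assms(8) zero(1)] by (simp add: R_def)
  \<comment> \<open>Measurability is shown on the state space, so that composition with
    \<open>X t\<close> gives adaptedness to the canonical filtration.\<close>
  have R_meas: "R t \<in> borel_measurable borel" if "0 \<le> t" for t
    unfolding R_def
    by (rule iter_pderiv_measurable[OF \<epsilon>_pos, where H = "\<lambda>p x. G t x p"])
       (use G_\<epsilon>[OF that assms(8)] G_meas dir_point_in zero in auto)
  have R_adapted: "(\<lambda>w. R t (X t w)) \<in> borel_measurable (canonical_filtration M X t)" if "0 \<le> t" for t
    by (rule measurable_compose[OF measurable_canonical_filtration[OF that] R_meas[OF that]])
  have R_int: "integrable M (\<lambda>w. R t (X t w))" if t: "0 \<le> t" for t
  proof -
    obtain h where h: "integrable M h"
        "AE w in M. \<forall>p\<in>param_box \<delta>. cmod (iter_pderiv \<delta> ?L (G t (X t w)) p) \<le> h w"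
      using G_dom[OF subseq_order.refl t] by auto
    show ?thesis
    proof (rule Bochner_Integration.integrable_bound[OF h(1)])
      show "(\<lambda>w. R t (X t w)) \<in> borel_measurable M"
        by (rule measurable_compose[OF X[OF t] R_meas[OF t]])
      show "AE w in M. cmod (R t (X t w)) \<le> norm (h w)"
        using h(2) by eventually_elim (use R_\<delta>[OF t] zero in fastforce)
    qed
  qed

  have G_int: "(\<integral>w\<in>A. G t (X t w) p \<partial>M) = (\<integral>w\<in>A. G s (X s w) p \<partial>M)"
    if st: "0 \<le> s" "s \<le> t" and A: "A \<in> sets (canonical_filtration M X s)"
      and p: "p \<in> param_box \<delta>" for s t A p
  proof -
    let ?l = "dir_point \<zeta> p"
    have l: "?l \<in> Xhat" using box[OF p] .
    have rel: "related_kernel Xhat \<phi> e (P (t - s))"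
      using assms(3) st by (simp add: related_semigroup_def)
    \<comment> \<open>Relatedness makes \<open>\<phi> ?l\<close> an eigenfunction of the kernel
      \<open>P (t - s)\<close>. The eigenvalue is the transform of \<open>P (t - s) e\<close>, which
      is given by \<psi>.\<close>
    have "(\<integral>y. \<phi> ?l y \<partial>P (t - s) x) = exp (- complex_of_real (t - s) * \<psi> ?l) * \<phi> ?l x" for x
      using rel assms(4) st l
      unfolding related_kernel_def negative_definite_function_of_def fourier_transform_def
      by (metis diff_ge_0_iff_ge)
    then have "(\<integral>w\<in>A. \<phi> ?l (X t w) \<partial>M)
        = (\<integral>w\<in>A. exp (- complex_of_real (t - s) * \<psi> ?l) * \<phi> ?l (X s w) \<partial>M)"
      using rel markov_process_integral[where f = "\<phi> ?l", OF assms(6) st _ A \<phi>_meas[OF l] \<phi>_le_1[OF l]]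
      by (simp add: related_kernel_def)
    also have "\<dots> = exp (- complex_of_real (t - s) * \<psi> ?l) * (\<integral>w\<in>A. \<phi> ?l (X s w) \<partial>M)"
      by simp
    finally have "exp (complex_of_real t * \<psi> ?l) * (\<integral>w\<in>A. \<phi> ?l (X t w) \<partial>M)
        = exp (complex_of_real t * \<psi> ?l) * exp (- complex_of_real (t - s) * \<psi> ?l) * (\<integral>w\<in>A. \<phi> ?l (X s w) \<partial>M)"
      by simp
    also have "exp (complex_of_real t * \<psi> ?l) * exp (- complex_of_real (t - s) * \<psi> ?l)
        = exp (complex_of_real s * \<psi> ?l)"
      by (simp add: algebra_simps flip: exp_add)
    finally show ?thesis
      by (simp add: G_def set_lebesgue_integral_def mult.commute mult.left_commute)
  qed

  have R_set: "(\<integral>w\<in>A. R t (X t w) \<partial>M) = iter_pderiv \<delta> ?L (\<lambda>p. \<integral>w\<in>A. G t (X t w) p \<partial>M) 0"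
    if t: "0 \<le> t" and A: "A \<in> sets M" for t A
  proof -
    \<comment> \<open>The event becomes a density with values 0 and 1. Majorants for
      \<open>M\<close> remain integrable majorants for \<open>N\<close>, and the set integral turns
      into a plain one.\<close>
    define N where "N = density M (\<lambda>w. ennreal (indicat_real A w))"
    have N: "(\<integral>w\<in>A. f w \<partial>M) = (\<integral>w. f w \<partial>N)" if "f \<in> borel_measurable M" for f :: "'w \<Rightarrow> complex"
      unfolding N_def set_lebesgue_integral_def
      by (rule integral_density[symmetric]) (use that A in auto)
    have GX: "(\<lambda>w. G t (X t w) p) \<in> borel_measurable M" if "p \<in> param_box \<delta>" for p
      by (rule measurable_compose[OF X[OF t] G_meas[OF box[OF that]]])
    have "(\<integral>w\<in>A. R t (X t w) \<partial>M) = (\<integral>w. iter_pderiv \<delta> ?L (G t (X t w)) 0 \<partial>N)"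
      using N[OF borel_measurable_integrable[OF R_int[OF t]]] by (simp add: R_\<delta>[OF t])
    also have "\<dots> = iter_pderiv \<delta> ?L (\<lambda>p. \<integral>w. G t (X t w) p \<partial>N) 0"
    proof (rule iter_pderiv_integral[symmetric, OF \<delta>(1) _ _ _ zero(1), where H = "\<lambda>p w. G t (X t w) p"])
      show "differentiable_along \<delta> ?L (\<lambda>p. G t (X t w) p)" for w
        using G_\<delta>(1)[OF t assms(8)] .
      show "(\<lambda>w. G t (X t w) p) \<in> borel_measurable N" if "p \<in> param_box \<delta>" for p
        using GX[OF that] by (simp add: N_def)
      fix ks assume "suffix ks ?L"
      then obtain h where h: "integrable M h" "AE w in M. \<forall>p\<in>param_box \<delta>.
          cmod (iter_pderiv \<delta> ks (G t (X t w)) p) \<le> h w"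
        using G_dom[OF suffix_imp_subseq t] by blast
      have "integrable N h"
        unfolding N_def using integrable_mult_indicator[OF A h(1)] borel_measurable_integrable[OF h(1)] A
        by (subst integrable_density) auto
      moreover have "AE w in N. \<forall>p\<in>param_box \<delta>. cmod (iter_pderiv \<delta> ks (G t (X t w)) p) \<le> h w"
        unfolding N_def using h(2) A by (subst AE_density) auto
      ultimately show "\<exists>h. integrable N h \<and> (AE w in N. \<forall>p\<in>param_box \<delta>.
          cmod (iter_pderiv \<delta> ks (\<lambda>p. G t (X t w) p) p) \<le> h w)"
        by blast
    qed
    also have "\<dots> = iter_pderiv \<delta> ?L (\<lambda>p. \<integral>w\<in>A. G t (X t w) p \<partial>M) 0"
      by (rule iter_pderiv_cong[OF _ zero(1)]) (simp add: N[OF GX])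
    finally show ?thesis .
  qed

  show ?thesis
    unfolding martingale_def
  proof (intro conjI allI impI)
    fix s t :: real
    assume st: "0 \<le> s" "s \<le> t"
    show "AE w in M. complex_cond_exp M (canonical_filtration M X s)
        (\<lambda>w. appell_character \<phi> \<epsilon> \<zeta> \<psi> \<nu> t (X t w)) w = appell_character \<phi> \<epsilon> \<zeta> \<psi> \<nu> s (X s w)"
      unfolding appell
    proof (rule complex_cond_exp_charact[OF sub])
      fix A assume A: "A \<in> sets (canonical_filtration M X s)"
      then have AM: "A \<in> sets M" using sub by (auto simp: subalgebra_def)
      have "(\<integral>w\<in>A. R t (X t w) \<partial>M) = (\<integral>w\<in>A. R s (X s w) \<partial>M)"
        \<comment> \<open>By \<open>R_set\<close> both sides are derivatives at 0 of functions of
          the box parameter, and by \<open>G_int\<close> these functions coincide on the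
          box.\<close>
        using st iter_pderiv_cong[OF G_int[OF st A] zero(1)] by (simp add: R_set AM)
      then show "(\<integral>w\<in>A. \<i> ^ multi_order \<nu> * R t (X t w) \<partial>M) = (\<integral>w\<in>A. \<i> ^ multi_order \<nu> * R s (X s w) \<partial>M)"
        by simp
    qed (use st R_int R_adapted in auto)
  qed (use sub subsetD[OF canonical_filtration_mono] R_int R_adapted in \<open>auto simp: appell\<close>)
qed

end
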